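(* Consider the many-server system described in the context, operated under any load balancing policy in the class LB-zero. Let $\theta_m = \frac{6\mu_1 v_m + 5(m-1)v_m}{C}$ for $1\le m\le M$. If $N$ satisfies $$\min\left\{\sum_{m=1}^M\theta_m,\ \frac{C(1-\xi)}{2\mu_1 C_M}\right\} N^{0.5-\alpha} \;\geq\; \log N \;\geq\; \max\left\{\frac{2\mu_1}{1-\xi},\ \frac{C}{\mu_1}\right\},$$ then for every $1\le m\le M$, $$\mathbb P\left(s_{1,m}^* - \frac{\theta_m\log N}{\sqrt{N}}\leq S_{1,m} \leq s_{1,m}^* + \frac{1}{N^\alpha} + \frac{\sum_{r\neq m}\theta_r\log N}{\sqrt{N}}\right) \geq 1-\frac{M}{N^3},$$ where $s^*_{1,m}=\lambda v_m$.
   Context: System: $N$ identical servers, each able to hold at most $b$ jobs ($b\ge 1$ finite: one in service, at most $b-1$ waiting), served FIFO; a job routed to a server already holding $b$ jobs is discarded. Jobs arrive as a Poisson process of rate $\lambda N$ with $\lambda = 1-N^{-\alpha}$, $0<\alpha<1/2$. Service times are i.i.d. Coxian with $M$ phases: phase $m$ lasts an exponential time with rate $\mu_m>0$; after completing phase $m<M$ the job enters phase $m+1$ with probability $p_m\in[0,1)$ and otherwise departs; after phase $M$ it departs. Let $v_m=\prod_{i=1}^{m-1}p_i/\mu_m$ (empty product $=1$), normalized so that $\sum_{m=1}^M v_m=1$; $\bar v=\min_m v_m$. State: $S_{i,m}(t)$ is the fraction of servers holding at least $i$ jobs whose job in service is in phase $m$, $S_i(t)=\sum_m S_{i,m}(t)$.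 A load balancing policy routes each arriving job based on the current state matrix $(S_{i,m}(t))$, and it is assumed the resulting finite-state CTMC is irreducible; $S=(S_{i,m})$ denotes a random matrix with its stationary distribution and $S_i=\sum_m S_{i,m}$. For a state $s$, $s_1=\sum_m s_{1,m}$ and $A_1(s)$ is the probability an incoming job is routed to a busy server given the state is $s$. LB-zero is the class of policies with $A_1(s)\le 1/\sqrt N$ for every possible state $s$ with $s_1\le 1-\frac{1}{N^\alpha\log N}$. Constants: for $2\le m\le M$, $a_m=\frac{\mu_m}{p_1\mu_1+\mu_m}$, $b_m=(1-a_m)\bigl(1+\sum_{r=m+1}^M \frac{v_r}{v_1}\bigr)-\frac{a_m v_m}{v_1}$, $c_m = 5(1-a_m)\sum_{r=m+1}^M (r-1)v_r + 5a_m \sum_{r=2}^{m-1} \frac{\mu_r v_r}{\mu_m} + 5(m-2)a_m v_m + 5 - a_m$; $\xi=\sum_{m=2}^M b_m\prod_{j=m+1}^M a_j$, $C_M=\sum_{m=2}^M c_m\prod_{j=m+1}^M a_j$ (empty sum $0$, empty product $1$); the paper asserts $0<\xi<1$, and $C=\sqrt{\frac{2\bar v^2\log(1/\xi)}{3M+(3M+4)\log(1/\xi)}}$. *)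

theory Defs
  imports Complex_Main
begin

text \<open>Aggregated state: n i m = number of servers holding at least i jobs whose job in
 service is in phase m (i in 1..b, m in 1..M), i.e. n i m = N * S_{i,m}; zero outside that range.\<close>
type_synonym state = "nat \<Rightarrow> nat \<Rightarrow> nat"

text \<open>Routing target: None = an idle server; Some (i,m) = a server holding exactly i jobs
 whose job in service is in phase m.\<close>
type_synonym target = "(nat \<times> nat) option"

definition valid_state :: "nat \<Rightarrow> nat \<Rightarrow> nat \<Rightarrow> state \<Rightarrow> bool" where
  "valid_state N b M n \<longleftrightarrow>
     (\<forall>i m. (i \<notin> {1..b} \<or> m \<notin> {1..M}) \<longrightarrow> n i m = 0) \<and>
     (\<forall>i m. 1 \<le> i \<longrightarrow> n (Suc i) m \<le> n i m) \<and>
     (\<Sum>m=1..M. n 1 m) \<le> N"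

definition empty_state :: state where "empty_state = (\<lambda>i m. 0)"

definition exact :: "state \<Rightarrow> nat \<Rightarrow> nat \<Rightarrow> nat" where
  "exact n i m = n i m - n (Suc i) m"

definition idle_count :: "nat \<Rightarrow> nat \<Rightarrow> state \<Rightarrow> nat" where
  "idle_count N M n = N - (\<Sum>m=1..M. n 1 m)"

definition arr_idle :: "state \<Rightarrow> state" where
  "arr_idle n = n(1 := (n 1)(1 := n 1 1 + 1))"

definition arr_busy :: "state \<Rightarrow> nat \<Rightarrow> nat \<Rightarrow> state" where
  "arr_busy n i m = n(Suc i := (n (Suc i))(m := n (Suc i) m + 1))"

text \<open>a server with exactly i jobs finishes phase m and its job enters phase m+1\<close>
definition phase_step :: "state \<Rightarrow> nat \<Rightarrow> nat \<Rightarrow> state" where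
  "phase_step n i m = (\<lambda>j k. if 1 \<le> j \<and> j \<le> i then
      (if k = m then n j k - 1 else if k = Suc m then n j k + 1 else n j k) else n j k)"

text \<open>a server with exactly i jobs finishes phase m and the job departs;
 the next job (if any) starts service in phase 1\<close>
definition depart :: "state \<Rightarrow> nat \<Rightarrow> nat \<Rightarrow> state" where
  "depart n i m = (\<lambda>j k. if 1 \<le> j \<and> j \<le> i then
      (n j k - (if k = m then 1 else 0)) + (if k = 1 \<and> j < i then 1 else 0) else n j k)"

definition pcont :: "nat \<Rightarrow> (nat \<Rightarrow> real) \<Rightarrow> nat \<Rightarrow> real" where
  "pcont M p m = (if m < M then p m else 0)"

definition ind :: "bool \<Rightarrow> real" where "ind P = (if P then 1 else 0)"

definition trans_rate ::
  "nat \<Rightarrow> nat \<Rightarrow> nat \<Rightarrow> real \<Rightarrow> (nat \<Rightarrow> real) \<Rightarrow> (nat \<Rightarrow> real)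
     \<Rightarrow> (state \<Rightarrow> target \<Rightarrow> real) \<Rightarrow> state \<Rightarrow> state \<Rightarrow> real" where
  "trans_rate N b M lam mu p pol n y =
     lam * real N * pol n None * ind (y = arr_idle n)
   + (\<Sum>i\<in>{1..<b}. \<Sum>m\<in>{1..M}. lam * real N * pol n (Some (i, m)) * ind (y = arr_busy n i m))
   + (\<Sum>i\<in>{1..b}. \<Sum>m\<in>{1..<M}. mu m * real (exact n i m) * p m * ind (y = phase_step n i m))
   + (\<Sum>i\<in>{1..b}. \<Sum>m\<in>{1..M}. mu m * real (exact n i m) * (1 - pcont M p m) * ind (y = depart n i m))"

definition qrate ::
  "nat \<Rightarrow> nat \<Rightarrow> nat \<Rightarrow> real \<Rightarrow> (nat \<Rightarrow> real) \<Rightarrow> (nat \<Rightarrow> real)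
     \<Rightarrow> (state \<Rightarrow> target \<Rightarrow> real) \<Rightarrow> state \<Rightarrow> state \<Rightarrow> real" where
  "qrate N b M lam mu p pol n y = (if y = n then 0 else trans_rate N b M lam mu p pol n y)"

definition state_space ::
  "nat \<Rightarrow> nat \<Rightarrow> nat \<Rightarrow> real \<Rightarrow> (nat \<Rightarrow> real) \<Rightarrow> (nat \<Rightarrow> real)
     \<Rightarrow> (state \<Rightarrow> target \<Rightarrow> real) \<Rightarrow> state set" where
  "state_space N b M lam mu p pol =
     {y. (\<lambda>x z. valid_state N b M x \<and> valid_state N b M z \<and> qrate N b M lam mu p pol x z > 0)\<^sup>*\<^sup>*
           empty_state y}"

definition irreducible ::
  "nat \<Rightarrow> nat \<Rightarrow> nat \<Rightarrow> real \<Rightarrow> (nat \<Rightarrow> real) \<Rightarrow> (nat \<Rightarrow> real)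
     \<Rightarrow> (state \<Rightarrow> target \<Rightarrow> real) \<Rightarrow> bool" where
  "irreducible N b M lam mu p pol \<longleftrightarrow>
     (\<forall>x\<in>state_space N b M lam mu p pol. \<forall>y\<in>state_space N b M lam mu p pol.
        (\<lambda>u w. u \<in> state_space N b M lam mu p pol \<and> w \<in> state_space N b M lam mu p pol
               \<and> qrate N b M lam mu p pol u w > 0)\<^sup>*\<^sup>* x y)"

definition policy_ok :: "nat \<Rightarrow> nat \<Rightarrow> nat \<Rightarrow> (state \<Rightarrow> target \<Rightarrow> real) \<Rightarrow> state \<Rightarrow> bool" where
  "policy_ok N b M pol n \<longleftrightarrow>
     (\<forall>t. pol n t \<ge> 0) \<and>
     pol n None + (\<Sum>i\<in>{1..b}. \<Sum>m\<in>{1..M}. pol n (Some (i, m))) = 1 \<and>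
     (pol n None > 0 \<longrightarrow> idle_count N M n > 0) \<and>
     (\<forall>i m. pol n (Some (i, m)) > 0 \<longrightarrow> i \<in> {1..b} \<and> m \<in> {1..M} \<and> exact n i m > 0)"

definition A1 :: "nat \<Rightarrow> nat \<Rightarrow> (state \<Rightarrow> target \<Rightarrow> real) \<Rightarrow> state \<Rightarrow> real" where
  "A1 b M pol n = (\<Sum>i\<in>{1..b}. \<Sum>m\<in>{1..M}. pol n (Some (i, m)))"

definition stationary ::
  "nat \<Rightarrow> nat \<Rightarrow> nat \<Rightarrow> real \<Rightarrow> (nat \<Rightarrow> real) \<Rightarrow> (nat \<Rightarrow> real)
     \<Rightarrow> (state \<Rightarrow> target \<Rightarrow> real) \<Rightarrow> (state \<Rightarrow> real) \<Rightarrow> bool" where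
  "stationary N b M lam mu p pol \<pi> \<longleftrightarrow>
     (let SS = state_space N b M lam mu p pol in
       (\<forall>x\<in>SS. \<pi> x \<ge> 0) \<and> (\<Sum>x\<in>SS. \<pi> x) = 1 \<and>
       (\<forall>y\<in>SS. (\<Sum>x\<in>SS. \<pi> x * qrate N b M lam mu p pol x y)
                = \<pi> y * (\<Sum>z\<in>SS. qrate N b M lam mu p pol y z)))"

definition v :: "(nat \<Rightarrow> real) \<Rightarrow> (nat \<Rightarrow> real) \<Rightarrow> nat \<Rightarrow> real" where
  "v mu p m = (\<Prod>i\<in>{1..<m}. p i) / mu m"

definition vbar :: "nat \<Rightarrow> (nat \<Rightarrow> real) \<Rightarrow> (nat \<Rightarrow> real) \<Rightarrow> real" where
  "vbar M mu p = Min (v mu p ` {1..M})"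

definition acoef :: "(nat \<Rightarrow> real) \<Rightarrow> (nat \<Rightarrow> real) \<Rightarrow> nat \<Rightarrow> real" where
  "acoef mu p m = mu m / (p 1 * mu 1 + mu m)"

definition bcoef :: "nat \<Rightarrow> (nat \<Rightarrow> real) \<Rightarrow> (nat \<Rightarrow> real) \<Rightarrow> nat \<Rightarrow> real" where
  "bcoef M mu p m = (1 - acoef mu p m) * (1 + (\<Sum>r\<in>{m+1..M}. v mu p r / v mu p 1))
                    - acoef mu p m * v mu p m / v mu p 1"

definition ccoef :: "nat \<Rightarrow> (nat \<Rightarrow> real) \<Rightarrow> (nat \<Rightarrow> real) \<Rightarrow> nat \<Rightarrow> real" where
  "ccoef M mu p m =
     5 * (1 - acoef mu p m) * (\<Sum>r\<in>{m+1..M}. (real r - 1) * v mu p r)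
   + 5 * acoef mu p m * (\<Sum>r\<in>{2..m-1}. mu r * v mu p r / mu m)
   + 5 * (real m - 2) * acoef mu p m * v mu p m + 5 - acoef mu p m"

definition xi :: "nat \<Rightarrow> (nat \<Rightarrow> real) \<Rightarrow> (nat \<Rightarrow> real) \<Rightarrow> real" where
  "xi M mu p = (\<Sum>m\<in>{2..M}. bcoef M mu p m * (\<Prod>j\<in>{m+1..M}. acoef mu p j))"

definition CM :: "nat \<Rightarrow> (nat \<Rightarrow> real) \<Rightarrow> (nat \<Rightarrow> real) \<Rightarrow> real" where
  "CM M mu p = (\<Sum>m\<in>{2..M}. ccoef M mu p m * (\<Prod>j\<in>{m+1..M}. acoef mu p j))"

definition Cconst :: "nat \<Rightarrow> (nat \<Rightarrow> real) \<Rightarrow> (nat \<Rightarrow> real) \<Rightarrow> real" where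
  "Cconst M mu p = sqrt (2 * (vbar M mu p)\<^sup>2 * ln (1 / xi M mu p)
        / (3 * real M + (3 * real M + 4) * ln (1 / xi M mu p)))"

definition theta :: "nat \<Rightarrow> (nat \<Rightarrow> real) \<Rightarrow> (nat \<Rightarrow> real) \<Rightarrow> nat \<Rightarrow> real" where
  "theta M mu p m = (6 * mu 1 * v mu p m + 5 * (real m - 1) * v mu p m) / Cconst M mu p"

end

theory Submission
  imports Defs
begin

text \<open>The number of busy servers in a phase, and the number of busy servers in phases 2 to m, change
  by unit jumps. A functional of this kind whose drift points downwards above some level has a
  geometric stationary tail, and if the drift condition fails on an exceptional set, the probability
  of that set enters with a factor 1 + 1/e, where e is log N divided by (C sqrt N).
  A lower bound lam v_1 - l for phase 1 propagates to lower bounds for the later phases, these give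
  upper bounds for the total of phases 2 to m, and the bound at m = M improves the first one to
  lam v_1 - max (xi l) (6 e): the constants fit since 1 - xi equals mu_1 times the product of all a_j.
  About log N / (2 log (1/xi)) rounds bring l down to 6 e, and C is so small that the
  geometric tails beat the factors accumulated on the way.\<close>

section \<open>A tail bound for functionals with unit jumps\<close>

text \<open>Waiting jobs act on the busy servers only through services that start in phase 1 right
  after a departure. This inflow depends on the queues and is not controlled from above, so phase 1
  gets tail bounds only from below, where the inflow may be dropped; from above it is bounded by one
  minus the mass of the other phases. Phases 2 to \<open>M\<close> are fed by the preceding phase
  alone, hence no queue length enters their drifts. Improving the bound for phase 1 rests on a
  dichotomy: little mass in phase 1 together with little in the other phases means idle servers,
  these attract almost all arrivals, and phase 1 fills up. The tail bound is stated for the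
  exceptional mass plus \<open>\<kappa>\<close>: in this form every application multiplies the same
  quantity by \<open>1 + 1 / \<rho>\<close>, and iterating it is just taking a power. Neither
  \<open>xi > 0\<close> nor \<open>v mu p m > 0\<close> is assumed (\<open>p m = 0\<close> is
  allowed); both are extracted from the two inequalities on \<open>log N\<close>, which force a
  positive \<open>Cconst\<close>.\<close>

lemma tail_bound:
  fixes h :: "'s \<Rightarrow> int" and up down \<pi> :: "'s \<Rightarrow> real" and \<rho> R thr thr' :: real and J :: nat
  defines "\<kappa> \<equiv> 1 / (1 + \<rho>) ^ J"
  assumes fin: "finite S" and pi0: "\<And>s. s \<in> S \<Longrightarrow> 0 \<le> \<pi> s" and pi1: "(\<Sum>s\<in>S. \<pi> s) = 1"
    and bal: "\<And>\<phi> :: int \<Rightarrow> real.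
      (\<Sum>s\<in>S. \<pi> s * (up s * (\<phi> (h s + 1) - \<phi> (h s)) + down s * (\<phi> (h s - 1) - \<phi> (h s)))) = 0"
    and down0: "\<And>s. s \<in> S \<Longrightarrow> 0 \<le> down s"
    and upR: "\<And>s. s \<in> S \<Longrightarrow> thr \<le> real_of_int (h s) \<Longrightarrow> up s \<le> R"
    and drift: "\<And>s. s \<in> S \<Longrightarrow> s \<in> E \<Longrightarrow> thr \<le> real_of_int (h s) \<Longrightarrow> up s + \<rho> * R \<le> down s"
    and R: "R > 0" and \<rho>: "\<rho> > 0" and J: "thr + real J + 1 \<le> thr'"
  shows "sum \<pi> (S - {s \<in> E. real_of_int (h s) \<le> thr'}) + \<kappa> \<le> (1 + 1 / \<rho>) * (sum \<pi> (S - E) + \<kappa>)"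
proof -
  \<comment> \<open>The test function has increments growing geometrically up to level \<open>k0 + J\<close>, where the drift
    outweighs the growth, and constant increments beyond, where the drift yields the mass.\<close>
  define k0 where "k0 = \<lceil>thr\<rceil>"
  define G where "G = (1 + \<rho>) ^ J"
  define \<Delta> where "\<Delta> i = (if i < k0 then 0 else (1 + \<rho>) ^ min (nat (i - k0)) J)" for i
  define \<phi> where "\<phi> i = (\<Sum>j\<in>{k0..<i}. \<Delta> j)" for i :: int
  have G: "G \<ge> 1" unfolding G_def using \<rho> by simp
  have \<Delta>G: "0 \<le> \<Delta> i" "\<Delta> i \<le> G" for i
    unfolding \<Delta>_def G_def using \<rho> by (auto intro!: power_increasing)
  have step: "\<phi> (i + 1) - \<phi> i = \<Delta> i" for i
  proof (cases "i < k0")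
    case False
    then have "{k0..<i + 1} = insert i {k0..<i}" by auto
    then show ?thesis unfolding \<phi>_def by simp
  qed (simp add: \<phi>_def \<Delta>_def)
  have step': "\<phi> (i - 1) - \<phi> i = - \<Delta> (i - 1)" for i
    using step[of "i - 1"] by simp
  \<comment> \<open>Three contributions: the unmatched first unit step at level \<open>k0\<close>
    costs \<open>R\<close>; a state outside \<open>E\<close>, whose downward rate is discarded,
    costs at most \<open>R * G\<close>; inside \<open>E\<close> beyond level \<open>k0 + J\<close>
    the drift gains \<open>\<rho> * R * G\<close>.\<close>
  define bnd where "bnd s = R * (1 + G * of_bool (s \<notin> E)
      - \<rho> * G * of_bool (s \<in> E \<and> k0 + int J < h s))" for s
  have pt: "up s * \<Delta> (h s) - down s * \<Delta> (h s - 1) \<le> bnd s" if s: "s \<in> S" for s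
  proof (cases "h s < k0")
    case True
    then show ?thesis using R G unfolding bnd_def \<Delta>_def by auto
  next
    case ge: False
    then have thr: "thr \<le> real_of_int (h s)" unfolding k0_def by linarith
    note u = upR[OF s thr]
    show ?thesis
    proof (cases "s \<in> E")
      case False
      have "up s * \<Delta> (h s) \<le> R * \<Delta> (h s)" using u \<Delta>G by (intro mult_right_mono) auto
      also have "\<dots> \<le> R * G" using \<Delta>G R by (intro mult_left_mono) auto
      finally have "up s * \<Delta> (h s) - down s * \<Delta> (h s - 1) \<le> R * G"
        using mult_nonneg_nonneg[OF down0[OF s] \<Delta>G(1), of "h s - 1"] by linarith
      then show ?thesis using False R unfolding bnd_def by (simp add: algebra_simps)
    next
      case True
      note d = drift[OF s True thr]
      consider "h s = k0" | "h s > k0" "h s \<le> k0 + int J" | "h s > k0 + int J" using ge by linarith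
      then show ?thesis
      proof cases
        case 1
        then show ?thesis using True u unfolding bnd_def \<Delta>_def by simp
      next
        case 2
        define D where "D = \<Delta> (h s - 1)"
        have D: "D \<ge> 0" unfolding D_def by (rule \<Delta>G)
        have "nat (h s - k0) = Suc (nat (h s - 1 - k0))" "nat (h s - k0) \<le> J" using 2 by auto
        then have "\<Delta> (h s) = (1 + \<rho>) * D" unfolding \<Delta>_def D_def using 2 by (simp add: min_def)
        moreover have "(up s + \<rho> * R) * D \<le> down s * D" using d D by (intro mult_right_mono)
        \<comment> \<open>Here \<open>up s \<le> R\<close> matters: the drift surplus
          \<open>\<rho> * R\<close> pays for the growth of the increments by the factor
          \<open>1 + \<rho>\<close>, which costs only \<open>\<rho> * up s\<close>.\<close>
        moreover have "\<rho> * D * up s \<le> \<rho> * D * R" using u D \<rho> by (intro mult_left_mono) auto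
        ultimately have "up s * \<Delta> (h s) - down s * D \<le> 0" by (simp add: algebra_simps)
        then show ?thesis using True 2 R unfolding bnd_def D_def by simp
      next
        case 3
        then have "min (nat (h s - k0)) J = J" "min (nat (h s - 1 - k0)) J = J" by auto
        then have "\<Delta> (h s) = G" "\<Delta> (h s - 1) = G" unfolding \<Delta>_def G_def using 3 by auto
        moreover have "(up s + \<rho> * R) * G \<le> down s * G" using d G by (intro mult_right_mono) auto
        ultimately show ?thesis using True 3 R unfolding bnd_def by (simp add: algebra_simps)
      qed
    qed
  qed
  define P where "P = sum \<pi> (S - E)"
  define P' where "P' = sum \<pi> {s \<in> S. s \<in> E \<and> k0 + int J < h s}"
  have Peq: "(\<Sum>s\<in>S. \<pi> s * of_bool (s \<notin> E)) = P"
    unfolding P_def using fin by (intro sum.mono_neutral_cong_right) auto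
  have Peq': "(\<Sum>s\<in>S. \<pi> s * of_bool (s \<in> E \<and> k0 + int J < h s)) = P'"
    unfolding P'_def using fin by (intro sum.mono_neutral_cong_right) auto
  have "0 = (\<Sum>s\<in>S. \<pi> s * (up s * \<Delta> (h s) - down s * \<Delta> (h s - 1)))"
    using bal[of \<phi>] by (simp add: step step')
  also have "\<dots> \<le> (\<Sum>s\<in>S. \<pi> s * bnd s)"
    using pt pi0 by (intro sum_mono mult_left_mono) auto
  also have "\<dots> = R * ((\<Sum>s\<in>S. \<pi> s) + G * (\<Sum>s\<in>S. \<pi> s * of_bool (s \<notin> E))
      - \<rho> * G * (\<Sum>s\<in>S. \<pi> s * of_bool (s \<in> E \<and> k0 + int J < h s)))"
    unfolding bnd_def sum_distrib_left sum.distrib[symmetric] sum_subtractf[symmetric]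
    by (intro sum.cong) (auto simp: algebra_simps)
  finally have "0 \<le> R * (1 + G * P - \<rho> * G * P')" by (simp only: Peq Peq' pi1)
  then have main: "\<rho> * G * P' \<le> 1 + G * P" using R by (simp add: zero_le_mult_iff)
  have "G * (\<rho> * P') \<le> G * (\<kappa> + P)"
    using main G unfolding \<kappa>_def G_def[symmetric] by (simp add: algebra_simps)
  then have "\<rho> * P' \<le> \<kappa> + P" using G by simp
  then have P': "P' \<le> 1 / \<rho> * (P + \<kappa>)" using \<rho> by (simp add: field_simps)
  have "sum \<pi> (S - {s \<in> E. real_of_int (h s) \<le> thr'})
      \<le> sum \<pi> ((S - E) \<union> {s \<in> S. s \<in> E \<and> k0 + int J < h s})"
  proof (rule sum_mono2)
    show "S - {s \<in> E. real_of_int (h s) \<le> thr'} \<subseteq> S - E \<union> {s \<in> S. s \<in> E \<and> k0 + int J < h s}"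
    proof
      fix s assume "s \<in> S - {s \<in> E. real_of_int (h s) \<le> thr'}"
      moreover have "k0 + int J < h s" if "thr' < real_of_int (h s)"
      proof -
        \<comment> \<open>Rounding \<open>thr\<close> up to an integer costs less than one level,
          which is the \<open>+ 1\<close> in the assumption on \<open>J\<close>.\<close>
        have "real_of_int k0 < thr + 1" unfolding k0_def by linarith
        then have "real_of_int (k0 + int J) < real_of_int (h s)" using that J by simp
        then show ?thesis by linarith
      qed
      ultimately show "s \<in> S - E \<union> {s \<in> S. s \<in> E \<and> k0 + int J < h s}" by force
    qed
  qed (use fin pi0 in auto)
  also have "\<dots> = P + P'"
    unfolding P_def P'_def using fin by (intro sum.union_disjoint) auto
  finally show ?thesis using P' unfolding P_def by (simp add: algebra_simps)
qed

section \<open>The coefficients\<close>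

text \<open>Both \<open>xi\<close> and \<open>CM\<close> have this shape. The affine recursion in
  the upper limit reduces statements about them to inductions over the phases.\<close>

lemma sum_prod_recursion:
  fixes f a :: "nat \<Rightarrow> real"
  assumes "1 \<le> m"
  shows "(\<Sum>k\<in>{2..Suc m}. f k * (\<Prod>j\<in>{k+1..Suc m}. a j))
    = a (Suc m) * (\<Sum>k\<in>{2..m}. f k * (\<Prod>j\<in>{k+1..m}. a j)) + f (Suc m)"
proof -
  have "(\<Prod>j\<in>{k+1..Suc m}. a j) = a (Suc m) * (\<Prod>j\<in>{k+1..m}. a j)" if "k \<in> {2..m}" for k
    using that by (simp add: prod.nat_ivl_Suc')
  then have "(\<Sum>k\<in>{2..m}. f k * (\<Prod>j\<in>{k+1..Suc m}. a j))
      = a (Suc m) * (\<Sum>k\<in>{2..m}. f k * (\<Prod>j\<in>{k+1..m}. a j))"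
    by (simp add: sum_distrib_left mult_ac)
  then show ?thesis using assms by (simp add: sum.nat_ivl_Suc')
qed

locale coxian_phases =
  fixes M :: nat and mu p :: "nat \<Rightarrow> real"
  assumes M: "M \<ge> 1"
    and mu: "\<And>m. m \<in> {1..M} \<Longrightarrow> mu m > 0"
    and p: "\<And>m. m \<in> {1..<M} \<Longrightarrow> 0 \<le> p m \<and> p m < 1"
    and norm: "(\<Sum>m=1..M. v mu p m) = 1"
begin

abbreviation w :: "nat \<Rightarrow> real" where "w \<equiv> v mu p"
abbreviation a :: "nat \<Rightarrow> real" where "a \<equiv> acoef mu p"

section \<open>Equilibrium phase weights and their flow balance\<close>

lemma mu_w: "m \<in> {1..M} \<Longrightarrow> mu m * w m = (\<Prod>i\<in>{1..<m}. p i)"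
  using mu[of m] unfolding v_def by simp

lemma w_1: "w 1 = 1 / mu 1" "mu 1 * w 1 = 1"
  using mu[of 1] M unfolding v_def by auto

lemma w_nonneg: "m \<in> {1..M} \<Longrightarrow> 0 \<le> w m"
  unfolding v_def using mu[of m] p by (intro divide_nonneg_pos prod_nonneg) auto

lemma w_le_1: "m \<in> {1..M} \<Longrightarrow> w m \<le> 1"
  using member_le_sum[of m "{1..M}" w] w_nonneg norm by auto

lemma mu_1_ge: "1 \<le> mu 1"
  using w_1 w_le_1[of 1] mu[of 1] M by (simp add: field_simps)

lemma w_flow:
  assumes "m \<in> {2..M}"
  shows "mu m * w m = mu (m - 1) * p (m - 1) * w (m - 1)"
proof -
  have "{1..<m} = insert (m - 1) {1..<m - 1}" using assms by auto
  then have "(\<Prod>i\<in>{1..<m}. p i) = p (m - 1) * (\<Prod>i\<in>{1..<m-1}. p i)" by simp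
  moreover have "m \<in> {1..M}" "m - 1 \<in> {1..M}" using assms by auto
  ultimately have "mu m * w m = p (m - 1) * (mu (m - 1) * w (m - 1))"
    using mu_w[of m] mu_w[of "m - 1"] by presburger
  then show ?thesis by (simp only: mult_ac)
qed

lemma w_flow_Suc: "m \<in> {1..<M} \<Longrightarrow> mu (Suc m) * w (Suc m) = mu m * p m * w m"
  using w_flow[of "Suc m"] by simp

lemma w_2: "2 \<le> M \<Longrightarrow> mu 2 * w 2 = p 1"
  using mu_w[of 2] by (simp add: numeral_2_eq_2)

text \<open>Telescoping: by \<open>w_flow_Suc\<close> each summand is
  \<open>mu r * w r - mu (Suc r) * w (Suc r)\<close>, the equilibrium flow through phase
  \<open>r\<close> minus the part passed on.\<close>

lemma sum_flow_loss:
  assumes "2 \<le> m" "m \<le> M"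
  shows "(\<Sum>r\<in>{2..<m}. (1 - p r) * mu r * w r) = p 1 - mu m * w m"
  using assms
proof (induction m rule: nat_induct_at_least)
  case base
  then show ?case using w_2 by simp
next
  case (Suc m)
  then show ?case using w_flow_Suc[of m] by (simp add: algebra_simps)
qed

text \<open>Summation by parts of the same differences. The weights \<open>r - 1\<close> are those
  of the slack in the lower bounds for the phases; the right-hand side is the form in which
  \<open>ccoef\<close> records that slack.\<close>

lemma sum_flow_loss_weighted:
  assumes "2 \<le> m" "m \<le> M"
  shows "(\<Sum>r\<in>{2..<m}. (1 - p r) * mu r * ((real r - 1) * w r))
    = (\<Sum>r\<in>{2..<m}. mu r * w r) - (real m - 2) * (mu m * w m)"
  using assms
proof (induction m rule: nat_induct_at_least)
  case (Suc m)
  have "(1 - p m) * mu m * ((real m - 1) * w m)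
      = (real m - 1) * (mu m * w m) - (real m - 1) * (mu m * p m * w m)"
    by (simp add: algebra_simps)
  also have "mu m * p m * w m = mu (Suc m) * w (Suc m)" using w_flow_Suc[of m] Suc by simp
  finally show ?case using Suc by (simp add: algebra_simps)
qed simp

text \<open>The bound on the drift of the total of phases 2 to \<open>m\<close> falls in that total
  with slope \<open>p 1 * mu 1 + mu m\<close>: the first part because more mass there leaves less
  for phase 1, the second because the excess over the total up to \<open>m - 1\<close> sits in phase
  \<open>m\<close>. The share of the second part is \<open>a m\<close>.\<close>

lemma a_facts:
  assumes "m \<in> {2..M}"
  shows "p 1 * mu 1 + mu m > 0" "0 < a m" "a m \<le> 1"
    "(p 1 * mu 1 + mu m) * a m = mu m" "(p 1 * mu 1 + mu m) * (1 - a m) = p 1 * mu 1"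
proof -
  have *: "0 \<le> p 1 * mu 1" "0 < mu m" using assms p[of 1] mu[of 1] mu[of m] by auto
  then show pos: "p 1 * mu 1 + mu m > 0" by simp
  show "0 < a m" "a m \<le> 1" using * pos unfolding acoef_def by auto
  show eq: "(p 1 * mu 1 + mu m) * a m = mu m" using pos unfolding acoef_def by simp
  show "(p 1 * mu 1 + mu m) * (1 - a m) = p 1 * mu 1" using eq by (simp add: algebra_simps)
qed

section \<open>Partial products and the closed form of \<open>xi\<close>\<close>

definition aprod :: "nat \<Rightarrow> real" where "aprod m = (\<Prod>j\<in>{2..m}. a j)"

lemma aprod_1: "aprod 1 = 1"
  unfolding aprod_def by simp

lemma aprod_Suc: "1 \<le> m \<Longrightarrow> aprod (Suc m) = a (Suc m) * aprod m"
  unfolding aprod_def by (simp add: prod.nat_ivl_Suc')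

lemma aprod_bounds: "m \<le> M \<Longrightarrow> 0 < aprod m \<and> aprod m \<le> 1"
  unfolding aprod_def using a_facts(2,3)
  by (intro conjI prod_pos prod_le_1) (auto intro: less_imp_le)

definition wsum :: "nat \<Rightarrow> real" where "wsum m = (\<Sum>r\<in>{2..m}. w r)"

lemma wsum_1: "wsum 1 = 0"
  unfolding wsum_def by simp

lemma wsum_Suc: "1 \<le> m \<Longrightarrow> wsum (Suc m) = wsum m + w (Suc m)"
  unfolding wsum_def by (simp add: sum.nat_ivl_Suc')

lemma wsum_tail:
  assumes "m \<in> {1..M}"
  shows "(\<Sum>r\<in>{m+1..M}. w r) = 1 - w 1 - wsum m"
proof -
  have "{1..M} = insert 1 ({2..m} \<union> {m+1..M})" using assms by auto
  then have "(\<Sum>r\<in>{1..M}. w r) = w 1 + (wsum m + (\<Sum>r\<in>{m+1..M}. w r))"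
    unfolding wsum_def using assms by (subst sum.union_disjoint[symmetric]) auto
  then show ?thesis using norm by simp
qed

lemma wsum_M: "wsum M = 1 - w 1"
  using wsum_tail[of M] M by simp

text \<open>With \<open>g m = mu 1 * (1 - wsum m)\<close> the right-hand side is
  \<open>g m - a m * g (m - 1)\<close>. Hence \<open>g\<close> solves the recursion for the partial
  sums of \<open>xi\<close> up to a multiple of \<open>aprod m\<close>.\<close>

lemma bcoef_eq:
  assumes "m \<in> {2..M}"
  shows "bcoef M mu p m = mu 1 * (1 - a m) - mu 1 * wsum m + a m * (mu 1 * wsum (m - 1))"
proof -
  have *: "x / w 1 = mu 1 * x" for x using w_1 by simp
  have "wsum m = wsum (m - 1) + w m" using wsum_Suc[of "m - 1"] assms by (cases m) auto
  moreover have "mu 1 * w 1 = 1" using w_1 by simp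
  moreover have "(\<Sum>r\<in>{m+1..M}. w r / w 1) = mu 1 * (1 - w 1 - wsum m)"
    using wsum_tail[of m] assms unfolding * sum_distrib_left[symmetric] by simp
  ultimately show ?thesis unfolding bcoef_def
    by (simp only: *) (simp add: algebra_simps)
qed

lemma xi_eq: "xi M mu p = 1 - mu 1 * aprod M"
proof -
  have "(\<Sum>k\<in>{2..m}. bcoef M mu p k * (\<Prod>j\<in>{k+1..m}. a j))
      = mu 1 * (1 - aprod m) - mu 1 * wsum m" if "1 \<le> m" "m \<le> M" for m
    using that
  proof (induction m rule: nat_induct_at_least)
    case base
    then show ?case using aprod_1 wsum_1 by simp
  next
    case (Suc m)
    then have IH: "(\<Sum>k\<in>{2..m}. bcoef M mu p k * (\<Prod>j\<in>{k+1..m}. a j))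
        = mu 1 * (1 - aprod m) - mu 1 * wsum m" by simp
    show ?case
      unfolding sum_prod_recursion[OF \<open>1 \<le> m\<close>] IH
      using Suc bcoef_eq[of "Suc m"] aprod_Suc[of m] by (simp add: algebra_simps)
  qed
  from this[of M] have "xi M mu p = mu 1 * (1 - aprod M) - mu 1 * wsum M"
    unfolding xi_def using M by simp
  moreover have "mu 1 * wsum M = mu 1 - 1" unfolding wsum_M using w_1(2) by (simp add: algebra_simps)
  ultimately show ?thesis by (simp add: algebra_simps)
qed

text \<open>This is nonnegativity of \<open>xi\<close>. The factor \<open>1 + mu 1 * wsum m\<close>
  strengthens the induction and equals \<open>mu 1\<close> at \<open>m = M\<close>; its growth in
  one step is absorbed because \<open>a m * (1 + p 1 * mu 1 / mu m) = 1\<close>.\<close>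

lemma mu_aprod_le_1: "mu 1 * aprod M \<le> 1"
proof -
  have "aprod m * (1 + mu 1 * wsum m) \<le> 1" if "1 \<le> m" "m \<le> M" for m
    using that
  proof (induction m rule: nat_induct_at_least)
    case base
    then show ?case using aprod_1 wsum_1 by simp
  next
    case (Suc m)
    have m: "Suc m \<in> {2..M}" using Suc by auto
    note am = a_facts[OF m] and b = aprod_bounds[of m]
    have pos: "0 \<le> mu 1 * w (Suc m)" "mu (Suc m) > 0"
      using mu_1_ge w_nonneg[of "Suc m"] mu[of "Suc m"] m by auto
    \<comment> \<open>No later phase has more equilibrium throughput than the flow
      \<open>p 1\<close> from phase 1 into phase 2.\<close>
    have "mu (Suc m) * w (Suc m) \<le> p 1"
    proof -
      have "(\<Prod>i\<in>{1..<Suc m}. p i) = p 1 * (\<Prod>i\<in>{2..<Suc m}. p i)"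
        using Suc(1) by (subst prod.atLeast_Suc_lessThan) (auto simp: numeral_2_eq_2)
      also have "\<dots> \<le> p 1 * 1"
        using p Suc by (intro mult_left_mono prod_le_1) (auto intro: less_imp_le)
      finally show ?thesis using mu_w[of "Suc m"] m by simp
    qed
    then have "mu 1 * (mu (Suc m) * w (Suc m)) \<le> mu 1 * p 1"
      using mu_1_ge by (intro mult_left_mono) auto
    then have key: "mu 1 * w (Suc m) \<le> p 1 * mu 1 / mu (Suc m)"
      using pos by (simp add: field_simps)
    have "aprod (Suc m) * (1 + mu 1 * wsum (Suc m))
        = a (Suc m) * (aprod m * (1 + mu 1 * wsum m) + aprod m * (mu 1 * w (Suc m)))"
      using Suc aprod_Suc[of m] wsum_Suc[of m] by (simp add: algebra_simps)
    also have "\<dots> \<le> a (Suc m) * (1 + 1 * (p 1 * mu 1 / mu (Suc m)))"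
      using Suc b am pos key by (intro mult_left_mono add_mono mult_mono) auto
    also have "\<dots> = ((p 1 * mu 1 + mu (Suc m)) * a (Suc m)) / mu (Suc m)"
      using pos by (simp add: field_simps)
    also have "\<dots> = 1"
      unfolding am(4) using pos by simp
    finally show ?case .
  qed
  from this[of M] have "aprod M * (1 + mu 1 * (1 - w 1)) \<le> 1" using M wsum_M by simp
  moreover have "1 + mu 1 * (1 - w 1) = mu 1" using w_1 by (simp add: algebra_simps)
  ultimately show ?thesis by (simp add: mult.commute)
qed

lemma xi_bounds: "0 \<le> xi M mu p" "xi M mu p < 1"
  using mu_aprod_le_1 xi_eq mu_1_ge aprod_bounds[of M] by auto

section \<open>Estimates for the error coefficients\<close>

definition Cpart :: "nat \<Rightarrow> real" where
  "Cpart m = (\<Sum>k\<in>{2..m}. ccoef M mu p k * (\<Prod>j\<in>{k+1..m}. a j))"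

lemma Cpart_1: "Cpart 1 = 0"
  unfolding Cpart_def by simp

lemma Cpart_Suc: "1 \<le> m \<Longrightarrow> Cpart (Suc m) = a (Suc m) * Cpart m + ccoef M mu p (Suc m)"
  unfolding Cpart_def by (rule sum_prod_recursion)

lemma Cpart_M: "Cpart M = CM M mu p"
  unfolding Cpart_def CM_def ..

text \<open>The left-hand side is what the drift computation for phases 2 to \<open>m\<close>
  consumes: slack in the lower bounds above \<open>m\<close> and below \<open>m\<close>, plus 4 for
  the margins. Of these, \<open>2 * e\<close> is the offset built into \<open>upper\<close> and
  \<open>2 * e\<close> the gap to the level of zero drift. By \<open>sum_flow_loss_weighted\<close>
  only the nonnegative terms \<open>10 * X\<close> and \<open>1 - a m\<close> are given
  away.\<close>

lemma ccoef_ge: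
  assumes "m \<in> {2..M}"
  shows "5 * (1 - a m) * (\<Sum>r\<in>{m+1..M}. (real r - 1) * w r)
      + 5 * (a m / mu m) * (\<Sum>r\<in>{2..<m}. (1 - p r) * mu r * ((real r - 1) * w r)) + 4
    \<le> ccoef M mu p m"
proof -
  have mm: "m \<in> {1..M}" "mu m > 0" using assms mu[of m] by auto
  define S Q L X where "S = (\<Sum>r\<in>{2..<m}. (1 - p r) * mu r * ((real r - 1) * w r))"
    and "Q = (\<Sum>r\<in>{2..<m}. mu r * w r)" and "L = (\<Sum>r\<in>{m+1..M}. (real r - 1) * w r)"
    and "X = (real m - 2) * a m * w m"
  have "{2..m-1} = {2..<m}" using assms by auto
  then have "(\<Sum>r\<in>{2..m-1}. mu r * w r / mu m) = Q / mu m"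
    unfolding Q_def by (simp add: sum_divide_distrib)
  then have c: "ccoef M mu p m = 5 * (1 - a m) * L + 5 * a m * (Q / mu m)
      + 5 * X + 5 - a m"
    unfolding ccoef_def L_def X_def by simp
  have SQ: "S = Q - (real m - 2) * (mu m * w m)"
    unfolding S_def Q_def using assms by (intro sum_flow_loss_weighted) auto
  then have S: "5 * (a m / mu m) * S = 5 * a m * (Q / mu m) - 5 * X"
    unfolding SQ X_def using mm by (simp add: field_simps)
  have "0 \<le> X"
    unfolding X_def using assms a_facts[OF assms] w_nonneg[OF mm(1)] by auto
  then show ?thesis
    using a_facts(3)[OF assms] c S unfolding S_def[symmetric] L_def[symmetric] by linarith
qed

lemma ccoef_ge_4:
  assumes m: "m \<in> {2..M}"
  shows "4 \<le> ccoef M mu p m"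
proof -
  have "0 \<le> (\<Sum>r\<in>{m+1..M}. (real r - 1) * w r)"
    using m w_nonneg by (intro sum_nonneg mult_nonneg_nonneg) auto
  then have "0 \<le> 5 * (1 - a m) * (\<Sum>r\<in>{m+1..M}. (real r - 1) * w r)"
    using a_facts(3)[OF m] by simp
  moreover have "0 \<le> (\<Sum>r\<in>{2..<m}. (1 - p r) * mu r * ((real r - 1) * w r))"
  proof (intro sum_nonneg)
    fix r assume "r \<in> {2..<m}"
    then show "0 \<le> (1 - p r) * mu r * ((real r - 1) * w r)"
      using m w_nonneg[of r] p[of r] mu[of r] by auto
  qed
  then have "0 \<le> 5 * (a m / mu m) * (\<Sum>r\<in>{2..<m}. (1 - p r) * mu r * ((real r - 1) * w r))"
    using m a_facts(2)[OF m] mu[of m] by simp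
  ultimately show ?thesis using ccoef_ge[OF m] by linarith
qed

lemma Cpart_nonneg: "1 \<le> m \<Longrightarrow> m \<le> M \<Longrightarrow> 0 \<le> Cpart m"
proof (induction m rule: nat_induct_at_least)
  case (Suc m)
  then show ?case
    using Cpart_Suc[of m] ccoef_ge_4[of "Suc m"] a_facts(2)[of "Suc m"] by simp
qed (simp add: Cpart_def)

lemma CM_ge_4:
  assumes "2 \<le> M"
  shows "4 \<le> CM M mu p"
proof -
  have "Suc (M - 1) = M" "1 \<le> M - 1" using assms by auto
  then have "CM M mu p = a M * Cpart (M - 1) + ccoef M mu p M"
    using Cpart_Suc[of "M - 1"] Cpart_M by metis
  moreover have "0 \<le> a M * Cpart (M - 1)"
    using Cpart_nonneg[of "M - 1"] a_facts(2)[of M] assms by simp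
  ultimately show ?thesis using ccoef_ge_4[of M] assms by simp
qed

end

section \<open>The generator acting on functions of the busy servers\<close>

text \<open>Integer valued, because lower tails are obtained by applying the tail bound to its
  negative.\<close>

definition cnt :: "nat set \<Rightarrow> state \<Rightarrow> int" where
  "cnt A s = int (\<Sum>r\<in>A. s 1 r)"

lemma cnt_arr_idle: "finite A \<Longrightarrow> cnt A (arr_idle s) = cnt A s + of_bool (1 \<in> A)"
  unfolding cnt_def arr_idle_def
  by (cases "1 \<in> A") (auto simp: sum.remove[of A 1] intro!: sum.cong)

lemma cnt_arr_busy: "1 \<le> i \<Longrightarrow> cnt A (arr_busy s i m) = cnt A s"
  unfolding cnt_def arr_busy_def by simp

lemma cnt_phase_step:
  assumes "finite A" "1 \<le> i" "1 \<le> s 1 m"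
  shows "cnt A (phase_step s i m) = cnt A s - of_bool (m \<in> A) + of_bool (Suc m \<in> A)"
proof -
  have "cnt A (phase_step s i m)
      = (\<Sum>r\<in>A. int (s 1 r) + (if r = m then - 1 else 0) + (if r = Suc m then 1 else 0))"
    unfolding cnt_def phase_step_def of_nat_sum using assms by (intro sum.cong) auto
  then show ?thesis using assms by (simp add: sum.distrib cnt_def)
qed

text \<open>A waiting job starts phase 1 at the very moment of the departure, so a server with
  \<open>1 < i\<close> moves from phase \<open>m\<close> to phase 1 in a single jump. The count
  therefore still changes by at most one.\<close>

lemma cnt_depart:
  assumes "finite A" "1 \<le> i" "1 \<le> s 1 m"
  shows "cnt A (depart s i m) = cnt A s - of_bool (m \<in> A) + of_bool (1 \<in> A \<and> 1 < i)"
proof -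
  have "cnt A (depart s i m)
      = (\<Sum>r\<in>A. int (s 1 r) + (if r = m then - 1 else 0) + (if r = 1 then of_bool (1 < i) else 0))"
    unfolding cnt_def depart_def of_nat_sum using assms by (intro sum.cong) auto
  then show ?thesis using assms by (simp add: sum.distrib cnt_def)
qed

section \<open>Transitions preserve valid states\<close>

lemma valid_state_antimono:
  assumes "valid_state N b M s" "1 \<le> i" "i \<le> j"
  shows "s j m \<le> s i m"
  using assms(3)
proof (induction rule: dec_induct)
  case (step k)
  then show ?case using assms unfolding valid_state_def by (meson le_trans)
qed simp

lemma valid_state_arr_idle:
  assumes "valid_state N b M s" "b \<ge> 1" "M \<ge> 1" "idle_count N M s > 0"
  shows "valid_state N b M (arr_idle s)"
proof -
  have "(\<Sum>m = 1..M. arr_idle s 1 m) = (\<Sum>m = 1..M. s 1 m + (if m = 1 then 1 else 0))"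
    unfolding arr_idle_def by (intro sum.cong) auto
  also have "\<dots> = (\<Sum>m = 1..M. s 1 m) + 1" using assms by (simp add: sum.distrib)
  finally have "(\<Sum>m = 1..M. arr_idle s 1 m) \<le> N" using assms by (simp add: idle_count_def)
  then show ?thesis using assms unfolding valid_state_def arr_idle_def by (auto intro: le_SucI)
qed

lemma valid_state_arr_busy:
  assumes "valid_state N b M s" "i \<in> {1..<b}" "m \<in> {1..M}" "exact s i m > 0"
  shows "valid_state N b M (arr_busy s i m)"
proof -
  have *: "(\<Sum>m' = 1..M. arr_busy s i m 1 m') = (\<Sum>m' = 1..M. s 1 m')"
    using assms by (simp add: arr_busy_def)
  have "s (Suc j) k \<le> s j k" if "1 \<le> j" for j k
    using assms(1) that unfolding valid_state_def by blast
  then have "arr_busy s i m (Suc j) k \<le> arr_busy s i m j k" if "1 \<le> j" for j k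
    using assms(4) that unfolding arr_busy_def exact_def by (auto intro: le_SucI)
  then show ?thesis using assms * unfolding valid_state_def by (auto simp: arr_busy_def)
qed

lemma valid_state_phase_step:
  assumes v: "valid_state N b M s" and i: "i \<in> {1..b}" and m: "m \<in> {1..<M}" and ex: "exact s i m > 0"
  shows "valid_state N b M (phase_step s i m)"
proof -
  have pos: "s j m \<ge> 1" if "1 \<le> j" "j \<le> i" for j
    using valid_state_antimono[OF v that, of m] ex unfolding exact_def by linarith
  have "cnt {1..M} (phase_step s i m) = cnt {1..M} s"
    using cnt_phase_step[of "{1..M}" i s m] i m pos[of 1] by auto
  then have *: "(\<Sum>m' = 1..M. phase_step s i m 1 m') = (\<Sum>m' = 1..M. s 1 m')"
    unfolding cnt_def by linarith
  have dec: "s (Suc j) k \<le> s j k" if "1 \<le> j" for j k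
    using v that unfolding valid_state_def by blast
  \<comment> \<open>All levels up to \<open>i\<close> are shifted alike, so only
    \<open>j = i\<close> is critical; there \<open>exact s i m > 0\<close> provides a strict drop to
    level \<open>Suc i\<close>.\<close>
  have "phase_step s i m (Suc j) k \<le> phase_step s i m j k" if j: "1 \<le> j" for j k
  proof (cases "j = i")
    case True
    then show ?thesis using dec[OF j, of k] ex j unfolding phase_step_def exact_def by auto
  next
    case False
    then show ?thesis using dec[OF j, of k] j unfolding phase_step_def by (auto intro: diff_le_mono)
  qed
  then show ?thesis using v i m * unfolding valid_state_def by (auto simp: phase_step_def)
qed

lemma valid_state_depart:
  assumes v: "valid_state N b M s" and i: "i \<in> {1..b}" and m: "m \<in> {1..M}" and ex: "exact s i m > 0"
  shows "valid_state N b M (depart s i m)"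
proof -
  have pos: "s j m \<ge> 1" if "1 \<le> j" "j \<le> i" for j
    using valid_state_antimono[OF v that, of m] ex unfolding exact_def by linarith
  have "cnt {1..M} (depart s i m) \<le> cnt {1..M} s"
    using cnt_depart[of "{1..M}" i s m] i m pos[of 1] by auto
  then have *: "(\<Sum>m' = 1..M. depart s i m 1 m') \<le> (\<Sum>m' = 1..M. s 1 m')"
    unfolding cnt_def by linarith
  have dec: "s (Suc j) k \<le> s j k" if "1 \<le> j" for j k
    using v that unfolding valid_state_def by blast
  have "depart s i m (Suc j) k \<le> depart s i m j k" if j: "1 \<le> j" for j k
  proof (cases "j = i")
    case True
    then show ?thesis using dec[OF j, of k] ex j unfolding depart_def exact_def by auto
  next
    case False
    then show ?thesis using dec[OF j, of k] j unfolding depart_def by (auto intro: diff_le_mono)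
  qed
  then show ?thesis using v i m * unfolding valid_state_def
    by (auto simp: depart_def intro: le_trans)
qed

lemma sum_ge_member:
  fixes f :: "'a \<Rightarrow> 'b \<Rightarrow> real"
  assumes "finite A" "finite B" "i \<in> A" "m \<in> B" "\<And>i m. i \<in> A \<Longrightarrow> m \<in> B \<Longrightarrow> 0 \<le> f i m"
  shows "f i m \<le> (\<Sum>i\<in>A. \<Sum>m\<in>B. f i m)"
proof -
  have "f i m \<le> (\<Sum>m\<in>B. f i m)" using assms by (intro member_le_sum) auto
  also have "\<dots> \<le> (\<Sum>i\<in>A. \<Sum>m\<in>B. f i m)" using assms by (intro member_le_sum sum_nonneg) auto
  finally show ?thesis .
qed

locale coxian_system = coxian_phases M mu p for M :: nat and mu p :: "nat \<Rightarrow> real" +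
  fixes N b :: nat and lam :: real
    and pol :: "state \<Rightarrow> target \<Rightarrow> real" and \<pi> :: "state \<Rightarrow> real"
  assumes b: "b \<ge> 1" and N: "N \<ge> 1" and lam0: "0 \<le> lam" and lam1: "lam \<le> 1"
    and pol: "\<And>s. s \<in> state_space N b M lam mu p pol \<Longrightarrow> policy_ok N b M pol s"
    and stat: "stationary N b M lam mu p pol \<pi>"
begin

definition SS :: "state set" where "SS = state_space N b M lam mu p pol"

abbreviation rate :: "state \<Rightarrow> state \<Rightarrow> real" where "rate \<equiv> qrate N b M lam mu p pol"

lemma pi_nonneg: "s \<in> SS \<Longrightarrow> 0 \<le> \<pi> s"
  and pi_sum: "sum \<pi> SS = 1"
  and balance: "s \<in> SS \<Longrightarrow> (\<Sum>x\<in>SS. \<pi> x * rate x s) = \<pi> s * (\<Sum>z\<in>SS. rate s z)"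
  using stat unfolding stationary_def SS_def Let_def by blast+

text \<open>A sum over an infinite set is 0 by convention, whereas \<open>\<pi>\<close> has total
  mass 1.\<close>

lemma finite_SS: "finite SS"
  using pi_sum by (metis sum.infinite zero_neq_one)

lemma valid_SS: "s \<in> SS \<Longrightarrow> valid_state N b M s"
  unfolding SS_def state_space_def mem_Collect_eq
  by (induction rule: rtranclp_induct) (auto simp: valid_state_def empty_state_def)

lemma SS_closed:
  assumes "x \<in> SS" "valid_state N b M y" "rate x y > 0"
  shows "y \<in> SS"
proof -
  let ?R = "\<lambda>x z. valid_state N b M x \<and> valid_state N b M z \<and> rate x z > 0"
  have "?R\<^sup>*\<^sup>* empty_state x" using assms(1) unfolding SS_def state_space_def mem_Collect_eq .
  then have "?R\<^sup>*\<^sup>* empty_state y"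
    by (rule rtranclp.rtrancl_into_rtrancl) (use assms valid_SS[OF assms(1)] in blast)
  then show ?thesis unfolding SS_def state_space_def mem_Collect_eq .
qed

lemma pol_SS: "s \<in> SS \<Longrightarrow> policy_ok N b M pol s"
  using pol unfolding SS_def .

lemma pol_nonneg: "s \<in> SS \<Longrightarrow> 0 \<le> pol s t"
  using pol_SS unfolding policy_ok_def by blast

lemma pcont_bounds: "m \<in> {1..M} \<Longrightarrow> 0 \<le> pcont M p m \<and> pcont M p m \<le> 1"
  using p[of m] unfolding pcont_def by auto

lemma ind_nonneg: "0 \<le> ind P"
  unfolding ind_def by simp

lemma trans_rate_terms_nonneg:
  assumes "s \<in> SS"
  shows "0 \<le> lam * real N * pol s t"
    and "m \<in> {1..<M} \<Longrightarrow> 0 \<le> mu m * real (exact s i m) * p m"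
    and "m \<in> {1..M} \<Longrightarrow> 0 \<le> mu m * real (exact s i m) * (1 - pcont M p m)"
  using lam0 pol_nonneg[OF assms] mu[of m] p[of m] pcont_bounds[of m] by auto

text \<open>The state space is closed under positive rates between valid states, and a nonzero
  coefficient forces a valid target: through \<open>policy_ok\<close> for arrivals, through
  \<open>exact s i m > 0\<close> for services. This is what permits replacing sums over
  \<open>SS\<close> by sums over transitions.\<close>

lemma transition_targets:
  assumes s: "s \<in> SS"
  shows "lam * real N * pol s None \<noteq> 0 \<Longrightarrow> arr_idle s \<in> SS"
    and "i \<in> {1..<b} \<Longrightarrow> m \<in> {1..M} \<Longrightarrow> lam * real N * pol s (Some (i, m)) \<noteq> 0 \<Longrightarrow> arr_busy s i m \<in> SS"
    and "i \<in> {1..b} \<Longrightarrow> m \<in> {1..<M} \<Longrightarrow> mu m * real (exact s i m) * p m \<noteq> 0 \<Longrightarrow> phase_step s i m \<in> SS"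
    and "i \<in> {1..b} \<Longrightarrow> m \<in> {1..M} \<Longrightarrow> mu m * real (exact s i m) * (1 - pcont M p m) \<noteq> 0
      \<Longrightarrow> depart s i m \<in> SS"
proof -
  note v = valid_SS[OF s] and nn = trans_rate_terms_nonneg[OF s]
  let ?a = "\<lambda>y. lam * real N * pol s None * ind (y = arr_idle s)"
  let ?b = "\<lambda>y i m. lam * real N * pol s (Some (i, m)) * ind (y = arr_busy s i m)"
  let ?c = "\<lambda>y i m. mu m * real (exact s i m) * p m * ind (y = phase_step s i m)"
  let ?d = "\<lambda>y i m. mu m * real (exact s i m) * (1 - pcont M p m) * ind (y = depart s i m)"
  have a0: "?a y \<ge> 0" for y using nn ind_nonneg by (intro mult_nonneg_nonneg[of _ "ind _"]) auto
  have b0: "?b y i m \<ge> 0" for y i m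
    using nn ind_nonneg by (intro mult_nonneg_nonneg[of _ "ind _"]) auto
  have c0: "m \<in> {1..<M} \<Longrightarrow> ?c y i m \<ge> 0" for y i m
    using nn ind_nonneg by (intro mult_nonneg_nonneg[of _ "ind _"]) auto
  have d0: "m \<in> {1..M} \<Longrightarrow> ?d y i m \<ge> 0" for y i m
    using nn ind_nonneg by (intro mult_nonneg_nonneg[of _ "ind _"]) auto
  have B0: "(\<Sum>i\<in>{1..<b}. \<Sum>m\<in>{1..M}. ?b y i m) \<ge> 0" for y by (intro sum_nonneg b0)
  have C0: "(\<Sum>i\<in>{1..b}. \<Sum>m\<in>{1..<M}. ?c y i m) \<ge> 0" for y by (intro sum_nonneg c0)
  have D0: "(\<Sum>i\<in>{1..b}. \<Sum>m\<in>{1..M}. ?d y i m) \<ge> 0" for y by (intro sum_nonneg d0)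
  \<comment> \<open>\<open>qrate\<close> vanishes on the diagonal, so a target equal to
    \<open>s\<close> needs its own, trivial, case.\<close>
  have key: "y \<in> SS" if "valid_state N b M y" "trans_rate N b M lam mu p pol s y > 0" for y
    using SS_closed[OF s that(1)] that(2) s unfolding qrate_def by (cases "y = s") auto
  have pos: "0 < x" if "0 \<le> x" "x \<noteq> 0" for x :: real using that by simp
  {
    assume *: "lam * real N * pol s None \<noteq> 0"
    then have "pol s None > 0" by (intro pos[OF pol_nonneg[OF s]]) auto
    then have "idle_count N M s > 0" using pol_SS[OF s] unfolding policy_ok_def by blast
    then have val: "valid_state N b M (arr_idle s)" using v b M by (intro valid_state_arr_idle)
    have "?a (arr_idle s) > 0" using pos[OF nn(1)[of None] *] by (simp add: ind_def)
    then show "arr_idle s \<in> SS" using B0[of "arr_idle s"] C0[of "arr_idle s"] D0[of "arr_idle s"]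
      by (intro key[OF val]) (simp add: trans_rate_def add_pos_nonneg)
  }
  {
    assume i: "i \<in> {1..<b}" and m: "m \<in> {1..M}" and *: "lam * real N * pol s (Some (i, m)) \<noteq> 0"
    let ?y = "arr_busy s i m"
    have "pol s (Some (i, m)) > 0"
      using * by (intro pos[OF pol_nonneg[OF s]]) auto
    then have "exact s i m > 0" using pol_SS[OF s] unfolding policy_ok_def by blast
    then have val: "valid_state N b M ?y" using v i m by (intro valid_state_arr_busy)
    have "?b ?y i m > 0" using pos[OF nn(1)[of "Some (i, m)"] *] by (simp add: ind_def)
    also have "?b ?y i m \<le> (\<Sum>i\<in>{1..<b}. \<Sum>m\<in>{1..M}. ?b ?y i m)"
      using i m b0 by (intro sum_ge_member[where f = "?b ?y"]) auto
    finally show "?y \<in> SS" using a0[of ?y] C0[of ?y] D0[of ?y]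
      by (intro key[OF val]) (simp add: trans_rate_def)
  }
  {
    assume i: "i \<in> {1..b}" and m: "m \<in> {1..<M}" and *: "mu m * real (exact s i m) * p m \<noteq> 0"
    let ?y = "phase_step s i m"
    have "exact s i m > 0" using * by (auto intro: gr0I)
    then have val: "valid_state N b M ?y" using v i m by (intro valid_state_phase_step)
    have "?c ?y i m > 0" using pos[OF nn(2)[OF m, of i] *] by (simp add: ind_def)
    also have "?c ?y i m \<le> (\<Sum>i\<in>{1..b}. \<Sum>m\<in>{1..<M}. ?c ?y i m)"
      using i m c0 by (intro sum_ge_member[where f = "?c ?y"]) auto
    finally show "?y \<in> SS" using a0[of ?y] B0[of ?y] D0[of ?y]
      by (intro key[OF val]) (simp add: trans_rate_def)
  }
  {
    assume i: "i \<in> {1..b}" and m: "m \<in> {1..M}"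
      and *: "mu m * real (exact s i m) * (1 - pcont M p m) \<noteq> 0"
    let ?y = "depart s i m"
    have "exact s i m > 0" using * by (auto intro: gr0I)
    then have val: "valid_state N b M ?y" using v i m by (intro valid_state_depart)
    have "?d ?y i m > 0" using pos[OF nn(3)[OF m, of i] *] by (simp add: ind_def)
    also have "?d ?y i m \<le> (\<Sum>i\<in>{1..b}. \<Sum>m\<in>{1..M}. ?d ?y i m)"
      using i m d0 by (intro sum_ge_member[where f = "?d ?y"]) auto
    finally show "?y \<in> SS" using a0[of ?y] B0[of ?y] C0[of ?y]
      by (intro key[OF val]) (simp add: trans_rate_def)
  }
qed

lemma sum_ind_target:
  fixes F :: "state \<Rightarrow> real"
  assumes "c \<noteq> 0 \<Longrightarrow> t \<in> SS"
  shows "(\<Sum>y\<in>SS. c * ind (y = t) * F y) = c * F t"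
proof (cases "c = 0")
  case False
  have "(\<Sum>y\<in>SS. c * ind (y = t) * F y) = (\<Sum>y\<in>SS. if y = t then c * F t else 0)"
    by (intro sum.cong) (auto simp: ind_def)
  then show ?thesis using finite_SS assms[OF False] by simp
qed simp

section \<open>The generator and its vanishing stationary mean\<close>

definition gen :: "(state \<Rightarrow> real) \<Rightarrow> state \<Rightarrow> real" where
  "gen F s = (\<Sum>y\<in>SS. rate s y * (F y - F s))"

lemma stationary_gen: "(\<Sum>s\<in>SS. \<pi> s * gen F s) = 0"
proof -
  have "(\<Sum>s\<in>SS. \<pi> s * (\<Sum>y\<in>SS. rate s y * F y)) = (\<Sum>y\<in>SS. \<Sum>s\<in>SS. \<pi> s * rate s y * F y)"
    by (subst sum.swap) (simp add: sum_distrib_left mult.assoc)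
  also have "\<dots> = (\<Sum>y\<in>SS. \<pi> y * (\<Sum>z\<in>SS. rate y z) * F y)"
    by (simp add: balance sum_distrib_right[symmetric])
  also have "\<dots> = (\<Sum>s\<in>SS. \<pi> s * (\<Sum>z\<in>SS. rate s z * F s))"
    by (simp add: sum_distrib_right mult.assoc)
  finally show ?thesis unfolding gen_def
    by (simp add: right_diff_distrib sum_subtractf)
qed

text \<open>Each indicator selects its own target, so coinciding targets add up correctly; the
  diagonal is harmless because the increment of \<open>F\<close> is zero there.\<close>

lemma gen_eq:
  assumes s: "s \<in> SS"
  shows "gen F s = lam * real N * pol s None * (F (arr_idle s) - F s)
   + (\<Sum>i\<in>{1..<b}. \<Sum>m\<in>{1..M}. lam * real N * pol s (Some (i, m)) * (F (arr_busy s i m) - F s))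
   + (\<Sum>i\<in>{1..b}. \<Sum>m\<in>{1..<M}. mu m * real (exact s i m) * p m * (F (phase_step s i m) - F s))
   + (\<Sum>i\<in>{1..b}. \<Sum>m\<in>{1..M}. mu m * real (exact s i m) * (1 - pcont M p m) * (F (depart s i m) - F s))"
proof -
  define H where "H y = F y - F s" for y
  have swap: "(\<Sum>y\<in>SS. (\<Sum>i\<in>A. \<Sum>m\<in>B. c i m * ind (y = t i m)) * H y)
      = (\<Sum>i\<in>A. \<Sum>m\<in>B. c i m * H (t i m))"
    if "\<And>i m. i \<in> A \<Longrightarrow> m \<in> B \<Longrightarrow> c i m \<noteq> 0 \<Longrightarrow> t i m \<in> SS" for A B :: "nat set" and c t
  proof -
    have "(\<Sum>y\<in>SS. (\<Sum>i\<in>A. \<Sum>m\<in>B. c i m * ind (y = t i m)) * H y)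
        = (\<Sum>i\<in>A. \<Sum>y\<in>SS. \<Sum>m\<in>B. c i m * ind (y = t i m) * H y)"
      by (subst sum.swap) (simp add: sum_distrib_right)
    also have "\<dots> = (\<Sum>i\<in>A. \<Sum>m\<in>B. \<Sum>y\<in>SS. c i m * ind (y = t i m) * H y)"
      by (intro sum.cong refl sum.swap)
    also have "\<dots> = (\<Sum>i\<in>A. \<Sum>m\<in>B. c i m * H (t i m))"
      using that by (intro sum.cong refl sum_ind_target) auto
    finally show ?thesis .
  qed
  have "gen F s = (\<Sum>y\<in>SS. trans_rate N b M lam mu p pol s y * H y)"
    unfolding gen_def qrate_def H_def by (intro sum.cong) auto
  also have "\<dots> = (\<Sum>y\<in>SS. lam * real N * pol s None * ind (y = arr_idle s) * H y)
   + (\<Sum>y\<in>SS. (\<Sum>i\<in>{1..<b}. \<Sum>m\<in>{1..M}. lam * real N * pol s (Some (i, m)) * ind (y = arr_busy s i m)) * H y)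
   + (\<Sum>y\<in>SS. (\<Sum>i\<in>{1..b}. \<Sum>m\<in>{1..<M}. mu m * real (exact s i m) * p m * ind (y = phase_step s i m)) * H y)
   + (\<Sum>y\<in>SS. (\<Sum>i\<in>{1..b}. \<Sum>m\<in>{1..M}. mu m * real (exact s i m) * (1 - pcont M p m) * ind (y = depart s i m)) * H y)"
    unfolding trans_rate_def by (simp only: distrib_right sum.distrib)
  also have "(\<Sum>y\<in>SS. lam * real N * pol s None * ind (y = arr_idle s) * H y)
      = lam * real N * pol s None * H (arr_idle s)"
    using transition_targets(1)[OF s] by (intro sum_ind_target)
  also have "(\<Sum>y\<in>SS. (\<Sum>i\<in>{1..<b}. \<Sum>m\<in>{1..M}. lam * real N * pol s (Some (i, m)) * ind (y = arr_busy s i m)) * H y)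
     = (\<Sum>i\<in>{1..<b}. \<Sum>m\<in>{1..M}. lam * real N * pol s (Some (i, m)) * H (arr_busy s i m))"
    using transition_targets(2)[OF s] by (intro swap)
  also have "(\<Sum>y\<in>SS. (\<Sum>i\<in>{1..b}. \<Sum>m\<in>{1..<M}. mu m * real (exact s i m) * p m * ind (y = phase_step s i m)) * H y)
     = (\<Sum>i\<in>{1..b}. \<Sum>m\<in>{1..<M}. mu m * real (exact s i m) * p m * H (phase_step s i m))"
    using transition_targets(3)[OF s] by (intro swap)
  also have "(\<Sum>y\<in>SS. (\<Sum>i\<in>{1..b}. \<Sum>m\<in>{1..M}. mu m * real (exact s i m) * (1 - pcont M p m) * ind (y = depart s i m)) * H y)
     = (\<Sum>i\<in>{1..b}. \<Sum>m\<in>{1..M}. mu m * real (exact s i m) * (1 - pcont M p m) * H (depart s i m))"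
    using transition_targets(4)[OF s] by (intro swap)
  finally show ?thesis unfolding H_def .
qed

lemma sum_exact:
  assumes s: "s \<in> SS" and "1 \<le> k"
  shows "(\<Sum>i\<in>{k..b}. real (exact s i m)) = real (s k m)"
proof (cases "k \<le> b")
  case True
  have le: "s (Suc i) m \<le> s i m" if "i \<in> {k..b}" for i
    using valid_SS[OF s] that \<open>1 \<le> k\<close> unfolding valid_state_def by auto
  have "(\<Sum>i\<in>{k..b}. real (exact s i m)) = - (\<Sum>i = k..b. real (s (Suc i) m) - real (s i m))"
    unfolding sum_negf[symmetric] by (intro sum.cong) (auto simp: exact_def of_nat_diff le)
  also have "\<dots> = real (s k m) - real (s (Suc b) m)"
    using True by (subst sum_Suc_diff) auto
  also have "s (Suc b) m = 0" using valid_SS[OF s] unfolding valid_state_def by auto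
  finally show ?thesis by simp
next
  case False
  then show ?thesis using valid_SS[OF s] unfolding valid_state_def by auto
qed

text \<open>The rate of upward jumps of \<open>cnt A\<close>. The last sum counts departures outside
  \<open>A\<close> from servers with at least two jobs, whose next job starts in phase 1.\<close>

definition inflow :: "nat set \<Rightarrow> state \<Rightarrow> real" where
  "inflow A s = lam * real N * pol s None * of_bool (1 \<in> A)
    + (\<Sum>m\<in>{1..<M}. mu m * p m * real (s 1 m) * of_bool (m \<notin> A \<and> Suc m \<in> A))
    + (\<Sum>m\<in>{1..M}. mu m * (1 - pcont M p m) * real (s 2 m) * of_bool (m \<notin> A \<and> 1 \<in> A))"

text \<open>The rate of downward jumps of \<open>cnt A\<close>. A departure in \<open>A\<close>
  counts if it empties the server, or if the next job starts outside \<open>A\<close>; this is the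
  reason for separating \<open>exact s 1 m\<close> from \<open>s 2 m\<close>.\<close>

definition outflow :: "nat set \<Rightarrow> state \<Rightarrow> real" where
  "outflow A s = (\<Sum>m\<in>{1..<M}. mu m * p m * real (s 1 m) * of_bool (m \<in> A \<and> Suc m \<notin> A))
    + (\<Sum>m\<in>{1..M}. mu m * (1 - pcont M p m)
        * (real (exact s 1 m) * of_bool (m \<in> A) + real (s 2 m) * of_bool (m \<in> A \<and> 1 \<notin> A)))"

lemma gen_cnt:
  assumes s: "s \<in> SS" and A: "finite A"
  shows "gen (\<lambda>s. \<phi> (cnt A s)) s = inflow A s * (\<phi> (cnt A s + 1) - \<phi> (cnt A s))
      + outflow A s * (\<phi> (cnt A s - 1) - \<phi> (cnt A s))"
proof -
  define c u d where "c = cnt A s" and "u = \<phi> (c + 1) - \<phi> c" and "d = \<phi> (c - 1) - \<phi> c"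
  have s1: "s 1 m \<ge> 1" if "exact s i m \<noteq> 0" "i \<in> {1..b}" for i m
    using valid_state_antimono[OF valid_SS[OF s], of 1 i m] that unfolding exact_def by auto
  have idle: "lam * real N * pol s None * (\<phi> (cnt A (arr_idle s)) - \<phi> (cnt A s))
      = lam * real N * pol s None * of_bool (1 \<in> A) * u"
    using A by (simp add: cnt_arr_idle u_def c_def)
  have busy: "(\<Sum>i\<in>{1..<b}. \<Sum>m\<in>{1..M}. lam * real N * pol s (Some (i, m))
      * (\<phi> (cnt A (arr_busy s i m)) - \<phi> (cnt A s))) = 0"
    by (intro sum.neutral ballI) (simp add: cnt_arr_busy)
  have "(\<Sum>i\<in>{1..b}. \<Sum>m\<in>{1..<M}. mu m * real (exact s i m) * p m
        * (\<phi> (cnt A (phase_step s i m)) - \<phi> (cnt A s)))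
      = (\<Sum>i\<in>{1..b}. \<Sum>m\<in>{1..<M}. real (exact s i m) * (mu m * p m
        * (of_bool (m \<notin> A \<and> Suc m \<in> A) * u + of_bool (m \<in> A \<and> Suc m \<notin> A) * d)))"
    (is "(\<Sum>i\<in>_. \<Sum>m\<in>_. ?l i m) = (\<Sum>i\<in>_. \<Sum>m\<in>_. ?r i m)")
  proof (intro sum.cong refl)
    fix i m assume "i \<in> {1..b}" "m \<in> {1..<M}"
    then show "?l i m = ?r i m"
      using cnt_phase_step[OF A, of i s m] s1[of i m]
      by (cases "exact s i m = 0") (auto simp: u_def d_def c_def of_bool_def)
  qed
  also have "\<dots> = (\<Sum>m\<in>{1..<M}. real (s 1 m) * (mu m * p m
        * (of_bool (m \<notin> A \<and> Suc m \<in> A) * u + of_bool (m \<in> A \<and> Suc m \<notin> A) * d)))"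
    by (subst sum.swap) (simp add: sum_distrib_right[symmetric] sum_exact[OF s])
  finally have step: "(\<Sum>i\<in>{1..b}. \<Sum>m\<in>{1..<M}. mu m * real (exact s i m) * p m
        * (\<phi> (cnt A (phase_step s i m)) - \<phi> (cnt A s)))
      = (\<Sum>m\<in>{1..<M}. mu m * p m * real (s 1 m) * of_bool (m \<notin> A \<and> Suc m \<in> A)) * u
      + (\<Sum>m\<in>{1..<M}. mu m * p m * real (s 1 m) * of_bool (m \<in> A \<and> Suc m \<notin> A)) * d"
    by (simp only: sum_distrib_right sum.distrib[symmetric]) (intro sum.cong refl, simp add: algebra_simps)
  have insert1: "{1..b} = insert 1 {2..b}" using b by auto
  have dep: "mu m * real (exact s i m) * (1 - pcont M p m) * (\<phi> (cnt A (depart s i m)) - \<phi> (cnt A s))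
      = real (exact s i m) * (mu m * (1 - pcont M p m)
        * (of_bool (m \<notin> A \<and> 1 \<in> A \<and> 1 < i) * u + of_bool (m \<in> A \<and> \<not> (1 \<in> A \<and> 1 < i)) * d))"
    if "i \<in> {1..b}" for i m
    using cnt_depart[OF A, of i s m] s1[of i m] that
    by (cases "exact s i m = 0") (auto simp: u_def d_def c_def of_bool_def)
  have "(\<Sum>i\<in>{1..b}. \<Sum>m\<in>{1..M}. mu m * real (exact s i m) * (1 - pcont M p m)
        * (\<phi> (cnt A (depart s i m)) - \<phi> (cnt A s)))
      = (\<Sum>i\<in>{1..b}. \<Sum>m\<in>{1..M}. real (exact s i m) * (mu m * (1 - pcont M p m)
        * (of_bool (m \<notin> A \<and> 1 \<in> A \<and> 1 < i) * u + of_bool (m \<in> A \<and> \<not> (1 \<in> A \<and> 1 < i)) * d)))"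
    by (intro sum.cong refl dep)
  also have "\<dots> = (\<Sum>m\<in>{1..M}. real (exact s 1 m) * (mu m * (1 - pcont M p m) * (of_bool (m \<in> A) * d)))
      + (\<Sum>i\<in>{2..b}. \<Sum>m\<in>{1..M}. real (exact s i m) * (mu m * (1 - pcont M p m)
        * (of_bool (m \<notin> A \<and> 1 \<in> A) * u + of_bool (m \<in> A \<and> 1 \<notin> A) * d)))"
    unfolding insert1 by (subst sum.insert) (auto intro!: sum.cong arg_cong2[where f = "(+)"])
  also have "(\<Sum>i\<in>{2..b}. \<Sum>m\<in>{1..M}. real (exact s i m) * (mu m * (1 - pcont M p m)
        * (of_bool (m \<notin> A \<and> 1 \<in> A) * u + of_bool (m \<in> A \<and> 1 \<notin> A) * d)))
      = (\<Sum>m\<in>{1..M}. real (s 2 m) * (mu m * (1 - pcont M p m)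
        * (of_bool (m \<notin> A \<and> 1 \<in> A) * u + of_bool (m \<in> A \<and> 1 \<notin> A) * d)))"
    by (subst sum.swap) (simp add: sum_distrib_right[symmetric] sum_exact[OF s])
  finally have depart: "(\<Sum>i\<in>{1..b}. \<Sum>m\<in>{1..M}. mu m * real (exact s i m) * (1 - pcont M p m)
        * (\<phi> (cnt A (depart s i m)) - \<phi> (cnt A s)))
      = (\<Sum>m\<in>{1..M}. mu m * (1 - pcont M p m) * real (s 2 m) * of_bool (m \<notin> A \<and> 1 \<in> A)) * u
      + (\<Sum>m\<in>{1..M}. mu m * (1 - pcont M p m)
        * (real (exact s 1 m) * of_bool (m \<in> A) + real (s 2 m) * of_bool (m \<in> A \<and> 1 \<notin> A))) * d"
    by (simp only: sum_distrib_right sum.distrib[symmetric]) (intro sum.cong refl, simp add: algebra_simps)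
  show ?thesis
    unfolding gen_eq[OF s] idle busy step depart inflow_def outflow_def
    by (simp add: u_def d_def c_def algebra_simps)
qed

lemma flow_nonneg:
  assumes s: "s \<in> SS"
  shows "0 \<le> inflow A s" "0 \<le> outflow A s"
proof -
  have 1: "m \<in> {1..<M} \<Longrightarrow> 0 \<le> mu m * p m" for m using mu[of m] p[of m] by auto
  have 2: "m \<in> {1..M} \<Longrightarrow> 0 \<le> mu m * (1 - pcont M p m)" for m
    using mu[of m] pcont_bounds[of m] by auto
  have 3: "0 \<le> lam * real N * pol s None" using trans_rate_terms_nonneg(1)[OF s] .
  show "0 \<le> inflow A s"
    unfolding inflow_def
    by (intro add_nonneg_nonneg sum_nonneg mult_nonneg_nonneg[of _ "of_bool _"]
        mult_nonneg_nonneg[of _ "real _"] 1 2 3) simp_all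
  show "0 \<le> outflow A s"
    unfolding outflow_def
    by (intro add_nonneg_nonneg sum_nonneg mult_nonneg_nonneg[of _ "of_bool _"]
        mult_nonneg_nonneg[of _ "real _"] mult_nonneg_nonneg[of _ "_ + _"] 1 2 3) simp_all
qed

lemma cnt_balance:
  assumes A: "finite A"
  shows "(\<Sum>s\<in>SS. \<pi> s * (inflow A s * (\<phi> (cnt A s + 1) - \<phi> (cnt A s))
      + outflow A s * (\<phi> (cnt A s - 1) - \<phi> (cnt A s)))) = 0"
  using stationary_gen[of "\<lambda>s. \<phi> (cnt A s)"] gen_cnt[OF _ A]
  by (simp cong: sum.cong)

section \<open>Tail bounds for the phase counts\<close>

definition bad :: "state set \<Rightarrow> real" where "bad E = sum \<pi> (SS - E)"

lemma cnt_upper_tail: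
  fixes thr thr' R \<rho> :: real
  assumes A: "finite A" and R: "R > 0" and \<rho>: "\<rho> > 0" and J: "thr + real J + 1 \<le> thr'"
    and up: "\<And>s. s \<in> SS \<Longrightarrow> thr \<le> cnt A s \<Longrightarrow> inflow A s \<le> R"
    and drift: "\<And>s. s \<in> SS \<Longrightarrow> s \<in> E \<Longrightarrow> thr \<le> cnt A s \<Longrightarrow> inflow A s + \<rho> * R \<le> outflow A s"
  shows "bad {s \<in> E. cnt A s \<le> thr'} + 1 / (1 + \<rho>) ^ J \<le> (1 + 1 / \<rho>) * (bad E + 1 / (1 + \<rho>) ^ J)"
  unfolding bad_def
proof (rule tail_bound[where up = "inflow A" and down = "outflow A" and R = R and thr = thr])
  show "inflow A s + \<rho> * R \<le> outflow A s"
    if "s \<in> SS" "s \<in> E" "thr \<le> real_of_int (cnt A s)" for s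
    using drift that .
qed (fact finite_SS pi_nonneg pi_sum cnt_balance[OF A] flow_nonneg(2) up R \<rho> J)+

text \<open>The tail bound for \<open>- cnt A\<close>, with the roles of inflow and outflow
  exchanged.\<close>

lemma cnt_lower_tail:
  fixes thr thr' R \<rho> :: real
  assumes A: "finite A" and R: "R > 0" and \<rho>: "\<rho> > 0" and J: "thr' + real J + 1 \<le> thr"
    and up: "\<And>s. s \<in> SS \<Longrightarrow> cnt A s \<le> thr \<Longrightarrow> outflow A s \<le> R"
    and drift: "\<And>s. s \<in> SS \<Longrightarrow> s \<in> E \<Longrightarrow> cnt A s \<le> thr \<Longrightarrow> outflow A s + \<rho> * R \<le> inflow A s"
  shows "bad {s \<in> E. thr' \<le> cnt A s} + 1 / (1 + \<rho>) ^ J \<le> (1 + 1 / \<rho>) * (bad E + 1 / (1 + \<rho>) ^ J)"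
proof -
  have bal: "(\<Sum>s\<in>SS. \<pi> s * (outflow A s * (\<phi> (- cnt A s + 1) - \<phi> (- cnt A s))
      + inflow A s * (\<phi> (- cnt A s - 1) - \<phi> (- cnt A s)))) = 0" for \<phi> :: "int \<Rightarrow> real"
    using cnt_balance[OF A, of "\<lambda>x. \<phi> (- x)"] by (simp add: algebra_simps minus_diff_commute)
  have J': "- thr + real J + 1 \<le> - thr'" using J by simp
  have "bad {s \<in> E. real_of_int (- cnt A s) \<le> - thr'} + 1 / (1 + \<rho>) ^ J
      \<le> (1 + 1 / \<rho>) * (bad E + 1 / (1 + \<rho>) ^ J)"
    unfolding bad_def
  proof (rule tail_bound[where up = "outflow A" and down = "inflow A" and R = R and thr = "- thr"])
    show "outflow A s \<le> R" if "s \<in> SS" "- thr \<le> real_of_int (- cnt A s)" for s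
      using up[OF that(1)] that(2) by simp
    show "outflow A s + \<rho> * R \<le> inflow A s"
      if "s \<in> SS" "s \<in> E" "- thr \<le> real_of_int (- cnt A s)" for s
      using drift[OF that(1,2)] that(3) by simp
  qed (fact finite_SS pi_nonneg pi_sum bal flow_nonneg(1) R \<rho> J')+
  then show ?thesis by simp
qed

section \<open>Flow rates in terms of phase fractions\<close>

definition S :: "nat \<Rightarrow> state \<Rightarrow> real" where "S m s = real (s 1 m) / real N"

definition T :: "nat \<Rightarrow> state \<Rightarrow> real" where "T m s = (\<Sum>r\<in>{2..m}. S r s)"

lemma S_count: "real (s 1 m) = real N * S m s"
  using N unfolding S_def by simp

lemmas S_count_Suc = S_count[unfolded One_nat_def]

lemma S_nonneg: "0 \<le> S m s"
  unfolding S_def by simp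

lemma T_1: "T 1 s = 0"
  unfolding T_def by simp

lemma T_step: "m \<in> {2..M} \<Longrightarrow> T m s = T (m - 1) s + S m s"
  unfolding T_def by (cases m) (auto simp: sum.nat_ivl_Suc')

lemma sum_S_le_1:
  assumes "s \<in> SS"
  shows "(\<Sum>r\<in>{1..M}. S r s) \<le> 1"
proof -
  have "(\<Sum>m=1..M. s 1 m) \<le> N" using valid_SS[OF assms] unfolding valid_state_def by blast
  then have "real (\<Sum>m=1..M. s 1 m) \<le> real N" by (simp only: of_nat_le_iff)
  then show ?thesis using N unfolding S_def sum_divide_distrib[symmetric] by simp
qed

lemma sum_S_split:
  assumes "m \<in> {1..M}"
  shows "(\<Sum>r\<in>{1..M}. S r s) = S 1 s + T m s + (\<Sum>r\<in>{m+1..M}. S r s)"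
proof -
  have "{1..M} = insert 1 ({2..m} \<union> {m+1..M})" using assms by auto
  then have "(\<Sum>r\<in>{1..M}. S r s) = S 1 s + (T m s + (\<Sum>r\<in>{m+1..M}. S r s))"
    unfolding T_def using assms by (subst sum.union_disjoint[symmetric]) auto
  then show ?thesis by simp
qed

lemma cnt_single: "real_of_int (cnt {m} s) = real N * S m s"
  unfolding cnt_def S_count[symmetric] by simp

lemma cnt_range: "real_of_int (cnt {2..m} s) = real N * T m s"
  unfolding cnt_def T_def by (simp add: S_count_Suc sum_distrib_left)

lemma exact_plus: "s \<in> SS \<Longrightarrow> real (exact s 1 m) + real (s 2 m) = real (s 1 m)"
  using valid_state_antimono[OF valid_SS, of s 1 2 m] unfolding exact_def
  by (simp add: numeral_2_eq_2 of_nat_diff)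

lemma inflow_single:
  assumes "m \<in> {2..M}"
  shows "inflow {m} s = real N * (mu (m - 1) * p (m - 1) * S (m - 1) s)"
proof -
  have "(\<Sum>k\<in>{1..<M}. mu k * p k * real (s 1 k) * of_bool (k \<notin> {m} \<and> Suc k \<in> {m}))
      = (\<Sum>k\<in>{1..<M}. if k = m - 1 then mu (m - 1) * p (m - 1) * real (s 1 (m - 1)) else 0)"
    using assms by (intro sum.cong) auto
  also have "\<dots> = mu (m - 1) * p (m - 1) * real (s 1 (m - 1))"
    using assms by (subst sum.delta) auto
  finally show ?thesis unfolding inflow_def using assms by (simp add: S_count_Suc mult_ac)
qed

lemma outflow_single:
  assumes s: "s \<in> SS" and m: "m \<in> {2..M}"
  shows "outflow {m} s = real N * (mu m * S m s)"
proof -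
  have 1: "(\<Sum>k\<in>{1..<M}. mu k * p k * real (s 1 k) * of_bool (k \<in> {m} \<and> Suc k \<notin> {m}))
      = mu m * pcont M p m * real (s 1 m)"
  proof -
    have "(\<Sum>k\<in>{1..<M}. mu k * p k * real (s 1 k) * of_bool (k \<in> {m} \<and> Suc k \<notin> {m}))
      = (\<Sum>k\<in>{1..<M}. if k = m then mu m * p m * real (s 1 m) else 0)"
      by (intro sum.cong) auto
    then show ?thesis using m unfolding pcont_def by (subst (asm) sum.delta) auto
  qed
  have "(\<Sum>k\<in>{1..M}. mu k * (1 - pcont M p k) * (real (exact s 1 k) * of_bool (k \<in> {m})
        + real (s 2 k) * of_bool (k \<in> {m} \<and> 1 \<notin> {m})))
      = (\<Sum>k\<in>{1..M}. if k = m then mu m * (1 - pcont M p m) * real (s 1 m) else 0)"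
    using m exact_plus[OF s, of m] by (intro sum.cong) auto
  also have "\<dots> = mu m * (1 - pcont M p m) * real (s 1 m)" using m by (subst sum.delta) auto
  finally show ?thesis unfolding outflow_def 1 by (simp add: S_count_Suc algebra_simps)
qed

text \<open>Only arrivals at idle servers are kept. Services started after a departure also feed
  phase 1, but for a lower tail an inflow may be underestimated.\<close>

lemma inflow_first: "s \<in> SS \<Longrightarrow> real N * (lam * pol s None) \<le> inflow {1} s"
proof -
  assume s: "s \<in> SS"
  have "0 \<le> (\<Sum>m\<in>{1..M}. mu m * (1 - pcont M p m) * real (s 2 m) * of_bool (m \<notin> {1} \<and> 1 \<in> {1::nat}))"
    using mu pcont_bounds by (intro sum_nonneg mult_nonneg_nonneg) (auto intro: less_imp_le)
  moreover have "0 \<le> (\<Sum>m\<in>{1..<M}. mu m * p m * real (s 1 m) * of_bool (m \<notin> {1} \<and> Suc m \<in> {1}))"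
    using mu p by (intro sum_nonneg mult_nonneg_nonneg) (auto intro: less_imp_le)
  ultimately show ?thesis unfolding inflow_def by (simp add: mult_ac)
qed

text \<open>The estimate treats every departure from phase 1 as a loss, even if a waiting job
  restarts that phase at once; so the queue lengths drop out.\<close>

lemma outflow_first:
  assumes s: "s \<in> SS" and M2: "2 \<le> M"
  shows "outflow {1} s \<le> real N * (mu 1 * S 1 s)"
proof -
  have "(\<Sum>k\<in>{1..<M}. mu k * p k * real (s 1 k) * of_bool (k \<in> {1} \<and> Suc k \<notin> {1}))
      = (\<Sum>k\<in>{1..<M}. if k = 1 then mu 1 * p 1 * real (s 1 1) else 0)"
    by (intro sum.cong) auto
  also have "\<dots> = mu 1 * p 1 * real (s 1 1)" using M2 by (subst sum.delta) auto
  finally have 1: "(\<Sum>k\<in>{1..<M}. mu k * p k * real (s 1 k) * of_bool (k \<in> {1} \<and> Suc k \<notin> {1}))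
      = mu 1 * p 1 * real (s 1 1)" .
  have "(\<Sum>k\<in>{1..M}. mu k * (1 - pcont M p k) * (real (exact s 1 k) * of_bool (k \<in> {1})
        + real (s 2 k) * of_bool (k \<in> {1} \<and> 1 \<notin> {1::nat})))
      = (\<Sum>k\<in>{1..M}. if k = 1 then mu 1 * (1 - p 1) * real (exact s 1 1) else 0)"
    using M2 by (intro sum.cong) (auto simp: pcont_def)
  also have "\<dots> = mu 1 * (1 - p 1) * real (exact s 1 1)" using M by (subst sum.delta) auto
  also have "\<dots> \<le> mu 1 * (1 - p 1) * real (s 1 1)"
    using mu[of 1] p[of 1] M2 by (intro mult_left_mono) (auto simp: exact_def)
  finally show ?thesis unfolding outflow_def 1 by (simp add: S_count_Suc algebra_simps)
qed

lemma inflow_range: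
  assumes m: "m \<in> {2..M}"
  shows "inflow {2..m} s = real N * (mu 1 * p 1 * S 1 s)"
proof -
  have "(\<Sum>k\<in>{1..<M}. mu k * p k * real (s 1 k) * of_bool (k \<notin> {2..m} \<and> Suc k \<in> {2..m}))
      = (\<Sum>k\<in>{1..<M}. if k = 1 then mu 1 * p 1 * real (s 1 1) else 0)"
    using m by (intro sum.cong) auto
  also have "\<dots> = mu 1 * p 1 * real (s 1 1)" using m by (subst sum.delta) auto
  finally show ?thesis unfolding inflow_def by (simp add: S_count_Suc mult_ac)
qed

text \<open>Moves between phases 2 to \<open>m\<close> cancel: phases before \<open>m\<close> lose
  only departing jobs, phase \<open>m\<close> loses everything it completes.\<close>

lemma outflow_range:
  assumes s: "s \<in> SS" and m: "m \<in> {2..M}"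
  shows "outflow {2..m} s = real N * ((\<Sum>r\<in>{2..<m}. (1 - p r) * mu r * S r s) + mu m * S m s)"
proof -
  have "(\<Sum>k\<in>{1..<M}. mu k * p k * real (s 1 k) * of_bool (k \<in> {2..m} \<and> Suc k \<notin> {2..m}))
      = (\<Sum>k\<in>{1..<M}. if k = m then mu m * p m * real (s 1 m) else 0)"
    using m by (intro sum.cong) auto
  also have "\<dots> = mu m * pcont M p m * real (s 1 m)"
    using m unfolding pcont_def by (subst sum.delta) auto
  finally have 1: "(\<Sum>k\<in>{1..<M}. mu k * p k * real (s 1 k) * of_bool (k \<in> {2..m} \<and> Suc k \<notin> {2..m}))
      = mu m * pcont M p m * real (s 1 m)" .
  have ins: "{2..m} = insert m {2..<m}" using m by auto
  have "(\<Sum>k\<in>{1..M}. mu k * (1 - pcont M p k) * (real (exact s 1 k) * of_bool (k \<in> {2..m})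
        + real (s 2 k) * of_bool (k \<in> {2..m} \<and> 1 \<notin> {2..m})))
      = (\<Sum>k\<in>{2..m}. mu k * (1 - pcont M p k) * real (s 1 k))"
    using m by (intro sum.mono_neutral_cong_right) (auto simp: exact_plus[OF s, unfolded One_nat_def, symmetric])
  also have "\<dots> = mu m * (1 - pcont M p m) * real (s 1 m)
      + (\<Sum>k\<in>{2..<m}. mu k * (1 - pcont M p k) * real (s 1 k))"
    unfolding ins by simp
  also have "(\<Sum>k\<in>{2..<m}. mu k * (1 - pcont M p k) * real (s 1 k))
      = real N * (\<Sum>k\<in>{2..<m}. (1 - p k) * mu k * S k s)"
    unfolding sum_distrib_left using m by (intro sum.cong) (auto simp: pcont_def S_count_Suc mult_ac)
  finally show ?thesis unfolding outflow_def 1 by (simp add: S_count_Suc algebra_simps)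
qed

end

section \<open>Iterative peeling of the state space\<close>

text \<open>\<open>e\<close> is the unit of all margins, later \<open>log N / (C * sqrt N)\<close>.
  \<open>J\<close> is the number of levels over which the tails decay, small enough for the
  narrowest margin \<open>N * vb * e\<close>. \<open>\<tau>\<close> and \<open>\<sigma>\<close> are
  the idleness threshold and the misrouting probability of the policy class. \<open>budget\<close>
  says that the accumulated errors fit into the spare capacity \<open>1 - lam\<close>, reduced by
  \<open>aprod M\<close>.\<close>

locale lb_zero_system = coxian_system M mu p N b lam pol \<pi>
  for M :: nat and mu p :: "nat \<Rightarrow> real" and N b :: nat and lam :: real
    and pol :: "state \<Rightarrow> target \<Rightarrow> real" and \<pi> :: "state \<Rightarrow> real" +
  fixes e \<tau> \<sigma> vb :: real and J :: nat
  assumes M2: "2 \<le> M" and vb: "0 < vb" "\<And>m. m \<in> {1..M} \<Longrightarrow> vb \<le> v mu p m"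
    and e: "0 < e" and J: "real J + 1 \<le> real N * vb * e"
    and idle: "\<And>s. s \<in> SS \<Longrightarrow> (\<Sum>m\<in>{1..M}. real (s 1 m) / real N) \<le> 1 - \<tau> \<Longrightarrow> 1 - \<sigma> \<le> pol s None"
    and budget: "\<tau> + CM M mu p * e \<le> (1 - lam) * aprod M"
    and \<sigma>: "0 \<le> \<sigma>" "\<sigma> \<le> mu 1 * e"
begin

text \<open>A deficit \<open>l\<close> in phase 1 is passed on in proportion to the weights, since
  \<open>w m * mu 1 = w m / w 1\<close>. Each further phase costs \<open>5 * w m * e\<close>: four
  units for the width of the tail, one for the drift. For \<open>l = 6 * e\<close> the total loss is
  \<open>theta m * log N / sqrt N\<close>.\<close>

definition lower :: "real \<Rightarrow> nat \<Rightarrow> real" where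
  "lower l m = w m * (lam - mu 1 * l) - 5 * (real m - 1) * w m * e"

text \<open>At least \<open>2 * e\<close> above the level at which the drift of \<^term>\<open>T m\<close> vanishes if all phases
  are at their lower bounds and \<^term>\<open>T (m - 1)\<close> is at its upper bound.\<close>

definition upper :: "real \<Rightarrow> nat \<Rightarrow> real" where
  "upper l m = (lam - mu 1 * l) * wsum m + (1 - aprod m) * (1 - (lam - mu 1 * l))
    + Cpart m * e - 2 * e * of_bool (2 \<le> m)"

definition \<kappa> :: real where "\<kappa> = 1 / (1 + e) ^ J"

text \<open>The exponent \<open>t\<close> counts applications of the tail bound; \<open>UNIV\<close>
  is good for \<open>t = 0\<close>.\<close>

definition good :: "nat \<Rightarrow> state set \<Rightarrow> bool" where
  "good t E \<longleftrightarrow> bad E + \<kappa> \<le> (1 + 1 / e) ^ t * \<kappa>"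

lemma good_step:
  assumes "good t E" "bad E' + \<kappa> \<le> (1 + 1 / e) * (bad E + \<kappa>)"
  shows "good (Suc t) E'"
proof -
  have "(1 + 1 / e) * (bad E + \<kappa>) \<le> (1 + 1 / e) * ((1 + 1 / e) ^ t * \<kappa>)"
    using assms(1) e unfolding good_def by (intro mult_left_mono) auto
  then show ?thesis using assms(2) unfolding good_def by simp
qed

lemma w_pos: "m \<in> {1..M} \<Longrightarrow> 0 < w m"
  using vb by force

lemma vb_le_1: "vb \<le> 1"
  using vb(2)[of 1] w_le_1[of 1] M by simp

lemma Npos: "0 < real N"
  using N by simp

lemma J_le: "vb \<le> c \<Longrightarrow> real J + 1 \<le> real N * (c * e)"
  using J e Npos by (smt (verit, ccfv_SIG) mult.assoc mult_le_cancel_left_pos mult_le_cancel_right_pos)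

section \<open>Lower bounds pass from phase to phase\<close>

lemma lower_1: "lower l 1 = lam * w 1 - l"
  using w_1(2) unfolding lower_def by (simp add: algebra_simps)

lemma lower_step:
  assumes l: "0 \<le> l" and m: "m \<in> {2..M}" and g: "good t E"
    and E: "\<And>s. s \<in> E \<Longrightarrow> lower l (m - 1) \<le> S (m - 1) s"
  shows "good (Suc t) {s \<in> E. lower l m \<le> S m s}"
proof (rule good_step[OF g])
  have mm: "mu m > 0" "0 < w m" "vb \<le> w m" "0 < mu 1" using m mu[of m] mu[of 1] w_pos[of m] vb(2)[of m] by auto
  have set: "{s \<in> E. lower l m \<le> S m s} = {s \<in> E. real N * lower l m \<le> cnt {m} s}"
    using Npos by (auto simp: cnt_single)
  have hi: "S m s \<le> lower l m + 4 * w m * e"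
    if "real_of_int (cnt {m} s) \<le> real N * (lower l m + 4 * w m * e)" for s
    using that Npos unfolding cnt_single by simp
  \<comment> \<open>Below the threshold the fraction is at most \<open>w m\<close>, which justifies
    \<open>N * mu m * w m\<close> as bound for the outflow.\<close>
  have "lower l m + 4 * w m * e = w m * lam - w m * (mu 1 * l) - (5 * real m - 9) * (w m * e)"
    unfolding lower_def by (simp add: algebra_simps)
  moreover have "w m * lam \<le> w m" using lam1 mm by (simp add: mult_left_le)
  moreover have "0 \<le> w m * (mu 1 * l)" using mm l by simp
  moreover have "0 \<le> (5 * real m - 9) * (w m * e)" using mm e m by simp
  ultimately have le_w: "lower l m + 4 * w m * e \<le> w m" by linarith
  \<comment> \<open>The choice of 5: at the threshold, four units up, the outflow plus one unit of
    drift equals the inflow guaranteed by the bound for phase \<open>m - 1\<close>.\<close>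
  have eq: "mu m * (lower l m + 5 * w m * e) = mu (m - 1) * p (m - 1) * lower l (m - 1)"
  proof -
    have "mu (m - 1) * p (m - 1) * lower l (m - 1)
        = (mu (m - 1) * p (m - 1) * w (m - 1)) * (lam - mu 1 * l - 5 * (real m - 2) * e)"
      unfolding lower_def using m by (simp add: of_nat_diff algebra_simps)
    also have "\<dots> = (mu m * w m) * (lam - mu 1 * l - 5 * (real m - 2) * e)"
      using w_flow[OF m] by simp
    finally show ?thesis unfolding lower_def by (simp add: algebra_simps)
  qed
  show "bad {s \<in> E. lower l m \<le> S m s} + \<kappa> \<le> (1 + 1 / e) * (bad E + \<kappa>)"
    unfolding set \<kappa>_def
  proof (rule cnt_lower_tail[where thr = "real N * (lower l m + 4 * w m * e)"
        and R = "real N * (mu m * w m)"])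
    show "real N * lower l m + real J + 1 \<le> real N * (lower l m + 4 * w m * e)"
      using J_le[of "4 * w m"] mm by (simp add: algebra_simps)
    fix s assume s: "s \<in> SS" and c: "cnt {m} s \<le> real N * (lower l m + 4 * w m * e)"
    note hs = hi[OF c]
    have "mu m * S m s \<le> mu m * w m" using hs le_w mm by simp
    then show "outflow {m} s \<le> real N * (mu m * w m)"
      unfolding outflow_single[OF s m] using Npos by simp
  next
    fix s assume s: "s \<in> SS" "s \<in> E" and c: "cnt {m} s \<le> real N * (lower l m + 4 * w m * e)"
    note hs = hi[OF c]
    have "m - 1 \<in> {1..M}" "m - 1 \<in> {1..<M}" using m by auto
    then have mp: "0 \<le> mu (m - 1) * p (m - 1)"
      using mu[of "m - 1"] p[of "m - 1"] by simp
    have "mu m * S m s + e * (mu m * w m) \<le> mu m * (lower l m + 4 * w m * e) + e * (mu m * w m)"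
      using hs mm by simp
    also have "\<dots> = mu (m - 1) * p (m - 1) * lower l (m - 1)"
      using eq by (simp add: algebra_simps)
    also have "\<dots> \<le> mu (m - 1) * p (m - 1) * S (m - 1) s"
      using E[OF s(2)] mp by (intro mult_left_mono)
    finally have "real N * (mu m * S m s + e * (mu m * w m)) \<le> real N * (mu (m - 1) * p (m - 1) * S (m - 1) s)"
      using Npos by (intro mult_left_mono) auto
    then show "outflow {m} s + e * (real N * (mu m * w m)) \<le> inflow {m} s"
      unfolding outflow_single[OF s(1) m] inflow_single[OF m] by (simp add: algebra_simps)
  qed (use mm Npos e in auto)
qed

lemma lower_all:
  assumes l: "0 \<le> l" and g: "good t E" and E: "\<And>s. s \<in> E \<Longrightarrow> lam * w 1 - l \<le> S 1 s"
  shows "\<exists>E'\<subseteq>E. good (t + (M - 1)) E' \<and> (\<forall>s\<in>E'. \<forall>r\<in>{1..M}. lower l r \<le> S r s)"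
proof -
  have "\<exists>E'\<subseteq>E. good (t + (m - 1)) E' \<and> (\<forall>s\<in>E'. \<forall>r\<in>{1..m}. lower l r \<le> S r s)"
    if "1 \<le> m" "m \<le> M" for m
    using that
  proof (induction m rule: nat_induct_at_least)
    case base
    then show ?case using g E lower_1[of l] by (intro exI[of _ E]) auto
  next
    case (Suc m)
    then obtain E' where E': "E' \<subseteq> E" "good (t + (m - 1)) E'"
      "\<And>s r. s \<in> E' \<Longrightarrow> r \<in> {1..m} \<Longrightarrow> lower l r \<le> S r s" by auto
    have "good (Suc (t + (m - 1))) {s \<in> E'. lower l (Suc m) \<le> S (Suc m) s}"
      using Suc E' by (intro lower_step[OF l]) auto
    moreover have "Suc (t + (m - 1)) = t + (Suc m - 1)" using Suc by simp
    ultimately show ?case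
      using E' by (intro exI[of _ "{s \<in> E'. lower l (Suc m) \<le> S (Suc m) s}"])
        (auto simp: le_Suc_eq)
  qed
  then show ?thesis using M by blast
qed

text \<open>Divided by \<open>p 1 * mu 1 + mu m\<close>, the left-hand side is the level of zero
  drift. With \<open>k = lam - mu 1 * l\<close> the lower bounds are \<open>k * w r\<close> up to
  slack; of the unassigned mass \<open>1 - k\<close> the phases 2 to \<open>m\<close> can hold the
  fraction \<open>1 - aprod m\<close>. These main terms balance exactly by flow conservation, and
  the terms in \<open>e\<close> obey the recursion of \<open>Cpart\<close>.\<close>

lemma upper_recursion:
  assumes m: "m \<in> {2..M}"
  shows "p 1 * mu 1 * (1 - (\<Sum>r\<in>{m+1..M}. lower l r)) + mu m * upper l (m - 1)
      - (\<Sum>r\<in>{2..<m}. (1 - p r) * mu r * lower l r)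
    \<le> (p 1 * mu 1 + mu m) * (upper l m - 2 * e)"
proof -
  define D where "D = p 1 * mu 1 + mu m"
  define k where "k = lam - mu 1 * l"
  define L where "L = (\<Sum>r\<in>{m+1..M}. (real r - 1) * w r)"
  define G where "G = (\<Sum>r\<in>{2..<m}. (1 - p r) * mu r * ((real r - 1) * w r))"
  note am = a_facts[OF m, folded D_def]
  obtain j where j: "m = Suc j" "1 \<le> j" using m by (cases m) auto
  have mm: "mu m > 0" using m mu[of m] by auto
  have DL: "D * (a m / mu m) = 1" using am mm by simp
  have lowL: "(\<Sum>r\<in>{m+1..M}. lower l r) = k * (1 - w 1 - wsum m) - 5 * e * L"
  proof -
    have "(\<Sum>r\<in>{m+1..M}. lower l r) = (\<Sum>r\<in>{m+1..M}. k * w r - 5 * e * ((real r - 1) * w r))"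
      unfolding lower_def k_def by (intro sum.cong) (auto simp: algebra_simps)
    also have "\<dots> = k * (\<Sum>r\<in>{m+1..M}. w r) - 5 * e * L"
      unfolding L_def sum_subtractf sum_distrib_left ..
    finally show ?thesis using wsum_tail[of m] m by simp
  qed
  have lowG: "(\<Sum>r\<in>{2..<m}. (1 - p r) * mu r * lower l r) = k * (p 1 - mu m * w m) - 5 * e * G"
  proof -
    have "(\<Sum>r\<in>{2..<m}. (1 - p r) * mu r * lower l r)
        = (\<Sum>r\<in>{2..<m}. k * ((1 - p r) * mu r * w r) - 5 * e * ((1 - p r) * mu r * ((real r - 1) * w r)))"
      unfolding lower_def k_def by (intro sum.cong) (auto simp: algebra_simps)
    also have "\<dots> = k * (\<Sum>r\<in>{2..<m}. (1 - p r) * mu r * w r) - 5 * e * G"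
      unfolding G_def sum_subtractf sum_distrib_left ..
    finally show ?thesis using sum_flow_loss[of m] m by simp
  qed
  have C: "D * (Cpart m) \<ge> mu m * Cpart (m - 1) + 5 * (p 1 * mu 1) * L + 5 * G + 4 * D"
  proof -
    have "5 * (1 - a m) * L + 5 * (a m / mu m) * G + 4 + a m * Cpart (m - 1) \<le> Cpart m"
      using ccoef_ge[OF m, folded L_def G_def] Cpart_Suc[OF j(2)] j(1) by simp
    then have "D * (5 * (1 - a m) * L + 5 * (a m / mu m) * G + 4 + a m * Cpart (m - 1)) \<le> D * Cpart m"
      using am by (intro mult_left_mono) auto
    moreover have "D * (5 * (1 - a m) * L + 5 * (a m / mu m) * G + 4 + a m * Cpart (m - 1))
        = 5 * (D * (1 - a m)) * L + 5 * (D * (a m / mu m)) * G + 4 * D + (D * a m) * Cpart (m - 1)"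
      by (simp only: distrib_left mult_ac)
    ultimately show ?thesis unfolding DL am(4,5) by simp
  qed
  have A: "D * aprod m = mu m * aprod (m - 1)"
    using aprod_Suc[OF j(2)] j(1) am(4) by (metis diff_Suc_1 mult.assoc)
  have W: "wsum m = wsum (m - 1) + w m" using wsum_Suc[OF j(2)] j(1) by simp
  have Ce: "mu m * Cpart (m - 1) * e + 5 * (p 1 * mu 1) * L * e + 5 * G * e + 4 * D * e \<le> D * Cpart m * e"
    using mult_right_mono[OF C, of e] e by (simp add: algebra_simps)
  have Ak: "D * aprod m * (1 - k) = mu m * aprod (m - 1) * (1 - k)" using A by simp
  have mw: "p 1 * (mu 1 * w 1) = p 1" using w_1(2) by simp
  have up: "upper l m - 2 * e = k * wsum m + (1 - aprod m) * (1 - k) + Cpart m * e - 4 * e"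
    using m unfolding upper_def k_def by simp
  have up': "upper l (m - 1) \<le> k * wsum (m - 1) + (1 - aprod (m - 1)) * (1 - k) + Cpart (m - 1) * e"
    using e unfolding upper_def k_def by simp
  have "p 1 * mu 1 * (1 - (\<Sum>r\<in>{m+1..M}. lower l r)) + mu m * upper l (m - 1)
      - (\<Sum>r\<in>{2..<m}. (1 - p r) * mu r * lower l r)
    \<le> p 1 * mu 1 * (1 - (k * (1 - w 1 - wsum m) - 5 * e * L))
      + mu m * (k * wsum (m - 1) + (1 - aprod (m - 1)) * (1 - k) + Cpart (m - 1) * e)
      - (k * (p 1 - mu m * w m) - 5 * e * G)"
    unfolding lowL lowG using mult_left_mono[OF up', of "mu m"] mm by linarith
  also have "\<dots> = D * (k * wsum m) + D * (1 - k) - mu m * aprod (m - 1) * (1 - k)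
      + mu m * Cpart (m - 1) * e + 5 * (p 1 * mu 1) * L * e + 5 * G * e
      + k * (p 1 * (mu 1 * w 1)) - k * p 1"
    unfolding D_def W by (simp add: algebra_simps)
  also have "\<dots> \<le> D * (k * wsum m) + D * (1 - k) - D * aprod m * (1 - k) + D * Cpart m * e - 4 * D * e"
    unfolding mw Ak using Ce by linarith
  also have "\<dots> = D * (upper l m - 2 * e)"
    unfolding up by (simp add: algebra_simps)
  finally show ?thesis unfolding D_def .
qed

lemma upper_step:
  assumes m: "m \<in> {2..M}" and g: "good t E"
    and low: "\<And>s r. s \<in> E \<Longrightarrow> r \<in> {1..M} \<Longrightarrow> lower l r \<le> S r s"
    and E: "\<And>s. s \<in> E \<Longrightarrow> T (m - 1) s \<le> upper l (m - 1)"
  shows "good (Suc t) {s \<in> E. T m s \<le> upper l m}"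
proof (rule good_step[OF g])
  have mm: "mu m > 0" "mu 1 > 0" using m mu[of m] mu[of 1] by auto
  \<comment> \<open>The normalization \<open>R\<close> contains \<open>p 1\<close>, which must be
    positive; this comes from \<open>w 2 > 0\<close>.\<close>
  have "0 < mu 2 * w 2" using w_pos[of 2] mu[of 2] M2 by simp
  then have p1: "0 < p 1" using w_2 M2 by simp
  then have pm: "0 < p 1 * mu 1" using mm by simp
  have set: "{s \<in> E. T m s \<le> upper l m} = {s \<in> E. cnt {2..m} s \<le> real N * upper l m}"
    using Npos by (auto simp: cnt_range)
  show "bad {s \<in> E. T m s \<le> upper l m} + \<kappa> \<le> (1 + 1 / e) * (bad E + \<kappa>)"
    unfolding set \<kappa>_def
  proof (rule cnt_upper_tail[where thr = "real N * (upper l m - e)" and R = "real N * (p 1 * mu 1)"])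
    show "real N * (upper l m - e) + real J + 1 \<le> real N * upper l m"
      using J_le[OF vb_le_1] by (simp add: algebra_simps)
    fix s assume s: "s \<in> SS"
    have "S 1 s \<le> (\<Sum>r\<in>{1..M}. S r s)" using M S_nonneg by (intro member_le_sum) auto
    then have "S 1 s \<le> 1" using sum_S_le_1[OF s] by simp
    then have "mu 1 * p 1 * S 1 s \<le> mu 1 * p 1 * 1" using pm by (intro mult_left_mono) (auto simp: mult_ac)
    then show "inflow {2..m} s \<le> real N * (p 1 * mu 1)"
      unfolding inflow_range[OF m] using Npos by (simp add: mult_ac)
  next
    fix s assume s: "s \<in> SS" "s \<in> E" and c: "real N * (upper l m - e) \<le> cnt {2..m} s"
    have Tm: "upper l m - e \<le> T m s" using c Npos unfolding cnt_range by simp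
    have "(\<Sum>r\<in>{m+1..M}. lower l r) \<le> (\<Sum>r\<in>{m+1..M}. S r s)"
      using low[OF s(2)] m by (intro sum_mono) auto
    then have "S 1 s \<le> 1 - T m s - (\<Sum>r\<in>{m+1..M}. lower l r)"
      using sum_S_le_1[OF s(1)] sum_S_split[of m s] m by simp
    then have 1: "p 1 * mu 1 * S 1 s \<le> p 1 * mu 1 * (1 - T m s - (\<Sum>r\<in>{m+1..M}. lower l r))"
      using pm by (intro mult_left_mono) auto
    have 2: "(\<Sum>r\<in>{2..<m}. (1 - p r) * mu r * lower l r) \<le> (\<Sum>r\<in>{2..<m}. (1 - p r) * mu r * S r s)"
    proof (intro sum_mono mult_left_mono)
      fix r assume r: "r \<in> {2..<m}"
      then show "lower l r \<le> S r s" using low[OF s(2), of r] m by auto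
      show "0 \<le> (1 - p r) * mu r" using p[of r] mu[of r] r m by auto
    qed
    have "T m s - upper l (m - 1) \<le> S m s" using T_step[OF m, of s] E[OF s(2)] by simp
    then have 3: "mu m * (T m s - upper l (m - 1)) \<le> mu m * S m s" using mm by simp
    have 4: "(p 1 * mu 1 + mu m) * (upper l m - e) \<le> (p 1 * mu 1 + mu m) * T m s"
      using Tm pm mm by (intro mult_left_mono) auto
    \<comment> \<open>Staying \<open>e\<close> above \<open>upper l m - 2 * e\<close> yields the
      drift \<open>(p 1 * mu 1 + mu m) * e\<close>; only the part with \<open>p 1 * mu 1\<close> is
      required.\<close>
    have 5: "0 \<le> mu m * e" using mm e by simp
    have "p 1 * mu 1 * S 1 s + e * (p 1 * mu 1)
        \<le> (\<Sum>r\<in>{2..<m}. (1 - p r) * mu r * S r s) + mu m * S m s"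
      using 1 2 3 4 5 upper_recursion[OF m, of l] by (simp add: algebra_simps)
    then have "real N * (p 1 * mu 1 * S 1 s + e * (p 1 * mu 1))
        \<le> real N * ((\<Sum>r\<in>{2..<m}. (1 - p r) * mu r * S r s) + mu m * S m s)"
      using Npos by (intro mult_left_mono) auto
    then show "inflow {2..m} s + e * (real N * (p 1 * mu 1)) \<le> outflow {2..m} s"
      unfolding outflow_range[OF s(1) m] inflow_range[OF m] by (simp add: algebra_simps)
  qed (use pm Npos e in auto)
qed

lemma upper_all:
  assumes g: "good t E"
    and low: "\<And>s r. s \<in> E \<Longrightarrow> r \<in> {1..M} \<Longrightarrow> lower l r \<le> S r s"
  shows "\<exists>E'\<subseteq>E. good (t + (M - 1)) E' \<and> (\<forall>s\<in>E'. T M s \<le> upper l M)"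
proof -
  have "\<exists>E'\<subseteq>E. good (t + (m - 1)) E' \<and> (\<forall>s\<in>E'. T m s \<le> upper l m)"
    if "1 \<le> m" "m \<le> M" for m
    using that
  proof (induction m rule: nat_induct_at_least)
    case base
    have "upper l 1 = 0" unfolding upper_def using wsum_1 aprod_1 Cpart_1 by simp
    then show ?case using g T_1 by (intro exI[of _ E]) auto
  next
    case (Suc m)
    then obtain E' where E': "E' \<subseteq> E" "good (t + (m - 1)) E'" "\<And>s. s \<in> E' \<Longrightarrow> T m s \<le> upper l m"
      by auto
    have "good (Suc (t + (m - 1))) {s \<in> E'. T (Suc m) s \<le> upper l (Suc m)}"
      using Suc E' low by (intro upper_step) auto
    moreover have "Suc (t + (m - 1)) = t + (Suc m - 1)" using Suc by simp
    ultimately show ?case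
      using E' by (intro exI[of _ "{s \<in> E'. T (Suc m) s \<le> upper l (Suc m)}"]) auto
  qed
  then show ?thesis using M by blast
qed

section \<open>Feedback from phases 2 to \<open>M\<close> to phase 1\<close>

lemma upper_M: "upper l M = 1 - lam * w 1 + xi M mu p * l - (1 - lam) * aprod M + CM M mu p * e - 2 * e"
proof -
  have "mu 1 * l * w 1 = l" using w_1(2) by (simp add: mult_ac)
  moreover have "upper l M = lam * (1 - w 1) - mu 1 * l + mu 1 * l * w 1 + (1 - aprod M) * (1 - lam)
      + mu 1 * l - mu 1 * aprod M * l + CM M mu p * e - 2 * e"
    unfolding upper_def wsum_M Cpart_M using M2 by (simp add: algebra_simps)
  ultimately show ?thesis unfolding xi_eq by (simp add: algebra_simps)
qed

text \<open>If \<^term>\<open>S 1 s\<close> were below the new bound while almost all servers are busy, the other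
  phases would carry more than \<^term>\<open>upper l M\<close>; hence the idle servers attract the arrivals.\<close>

lemma first_phase_step:
  assumes l: "0 \<le> l" and g: "good t E" and E: "\<And>s. s \<in> E \<Longrightarrow> T M s \<le> upper l M"
  defines "l' \<equiv> max (xi M mu p * l) (6 * e)"
  shows "good (Suc t) {s \<in> E. lam * w 1 - l' \<le> S 1 s}"
proof (rule good_step[OF g])
  have m1: "1 \<le> mu 1" by (rule mu_1_ge)
  have set: "{s \<in> E. lam * w 1 - l' \<le> S 1 s} = {s \<in> E. real N * (lam * w 1 - l') \<le> cnt {1} s}"
    using Npos by (auto simp: cnt_single)
  have l': "xi M mu p * l \<le> l'" "6 * e \<le> l'" unfolding l'_def by auto
  have hi: "S 1 s \<le> lam * w 1 - l' + 2 * e"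
    if "real_of_int (cnt {1} s) \<le> real N * (lam * w 1 - l' + 2 * e)" for s
    using that Npos unfolding cnt_single by simp
  \<comment> \<open>Of the \<open>6 * e\<close> in \<open>l'\<close>, two units are the width of the
    tail. The remaining four cover the misrouted arrivals \<open>\<sigma> \<le> mu 1 * e\<close> and
    the drift \<open>e\<close>.\<close>
  have muS: "mu 1 * S 1 s \<le> lam - 4 * (mu 1 * e)"
    if "real_of_int (cnt {1} s) \<le> real N * (lam * w 1 - l' + 2 * e)" for s
  proof -
    have "mu 1 * S 1 s \<le> mu 1 * (lam * w 1 - 4 * e)"
      using hi[OF that] l' m1 by (intro mult_left_mono) auto
    also have "\<dots> = lam * (mu 1 * w 1) - 4 * (mu 1 * e)" by (simp add: algebra_simps)
    finally show ?thesis unfolding w_1(2) by simp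
  qed
  have mue: "e \<le> mu 1 * e" using m1 e by simp
  show "bad {s \<in> E. lam * w 1 - l' \<le> S 1 s} + \<kappa> \<le> (1 + 1 / e) * (bad E + \<kappa>)"
    unfolding set \<kappa>_def
  proof (rule cnt_lower_tail[where thr = "real N * (lam * w 1 - l' + 2 * e)" and R = "real N"])
    show "real N * (lam * w 1 - l') + real J + 1 \<le> real N * (lam * w 1 - l' + 2 * e)"
      using J_le[of 2] vb_le_1 by (simp add: algebra_simps)
    fix s assume s: "s \<in> SS" and c: "cnt {1} s \<le> real N * (lam * w 1 - l' + 2 * e)"
    have "mu 1 * S 1 s \<le> 1" using muS[OF c] lam1 e mue by linarith
    then have "real N * (mu 1 * S 1 s) \<le> real N" using Npos by simp
    then show "outflow {1} s \<le> real N" using outflow_first[OF s M2] by linarith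
  next
    fix s assume s: "s \<in> SS" "s \<in> E" and c: "cnt {1} s \<le> real N * (lam * w 1 - l' + 2 * e)"
    have "(\<Sum>r\<in>{1..M}. S r s) = S 1 s + T M s" using sum_S_split[of M s] M by simp
    \<comment> \<open>The offset \<open>- 2 * e\<close> in \<open>upper\<close> cancels the tail
      width \<open>2 * e\<close>, \<open>xi * l \<le> l'\<close> cancels the deficits, and
      \<open>budget\<close> handles the rest.\<close>
    then have "(\<Sum>r\<in>{1..M}. S r s) \<le> 1 - \<tau>"
      using hi[OF c] E[OF s(2)] upper_M[of l] l' budget by linarith
    then have "1 - \<sigma> \<le> pol s None" using idle[OF s(1)] unfolding S_def by simp
    then have "lam * (1 - \<sigma>) \<le> lam * pol s None" using lam0 by (intro mult_left_mono)
    moreover have "lam * (1 - \<sigma>) = lam - lam * \<sigma>" by (simp add: right_diff_distrib)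
    moreover have "lam * \<sigma> \<le> \<sigma>" using lam1 lam0 \<sigma>(1) by (simp add: mult_left_le_one_le)
    ultimately have "mu 1 * S 1 s + e \<le> lam * pol s None"
      using muS[OF c] \<sigma>(2) mue e by linarith
    then have "real N * (mu 1 * S 1 s + e) \<le> real N * (lam * pol s None)"
      using Npos by (intro mult_left_mono) auto
    then show "outflow {1} s + e * real N \<le> inflow {1} s"
      using outflow_first[OF s(1) M2] inflow_first[OF s(1)] by (simp add: algebra_simps)
  qed (use Npos e in auto)
qed

text \<open>A round consists of \<open>M - 1\<close> lower bounds, \<open>M - 1\<close> upper bounds
  and one improvement for phase 1, hence \<open>2 * M - 1\<close> tail bounds, and contracts the
  deficit by \<open>xi\<close> until the floor \<open>6 * e\<close> is reached.\<close>

lemma peeling_iteration: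
  "\<exists>E. good (k * (2 * M - 1)) E \<and> (\<forall>s\<in>E. lam * w 1 - max (xi M mu p ^ k) (6 * e) \<le> S 1 s)"
proof (induction k)
  case 0
  \<comment> \<open>For \<open>k = 0\<close> the deficit is at least 1, so the bound follows from
    \<open>0 \<le> S 1 s\<close>.\<close>
  have "lam * w 1 \<le> 1 * 1" using lam0 lam1 w_le_1[of 1] w_nonneg[of 1] M by (intro mult_mono) auto
  then have "lam * w 1 - max 1 (6 * e) \<le> S 1 s" for s using S_nonneg[of 1 s] by linarith
  moreover have "good 0 UNIV" unfolding good_def bad_def by simp
  ultimately show ?case by (intro exI[of _ UNIV]) simp
next
  case (Suc k)
  define l where "l = max (xi M mu p ^ k) (6 * e)"
  have l: "0 \<le> l" unfolding l_def using e by simp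
  from Suc obtain E where E: "good (k * (2 * M - 1)) E" "\<And>s. s \<in> E \<Longrightarrow> lam * w 1 - l \<le> S 1 s"
    unfolding l_def by blast
  obtain E1 where E1: "good (k * (2 * M - 1) + (M - 1)) E1"
    "\<And>s r. s \<in> E1 \<Longrightarrow> r \<in> {1..M} \<Longrightarrow> lower l r \<le> S r s"
    using lower_all[OF l E] by blast
  obtain E2 where E2: "good (k * (2 * M - 1) + (M - 1) + (M - 1)) E2"
    "\<And>s. s \<in> E2 \<Longrightarrow> T M s \<le> upper l M"
    using upper_all[OF E1] by blast
  define l' where "l' = max (xi M mu p * l) (6 * e)"
  have "Suc (k * (2 * M - 1) + (M - 1) + (M - 1)) = Suc k * (2 * M - 1)" using M by simp
  then have "good (Suc k * (2 * M - 1)) {s \<in> E2. lam * w 1 - l' \<le> S 1 s}"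
    using first_phase_step[OF l E2] unfolding l'_def by metis
  moreover have "l' \<le> max (xi M mu p ^ Suc k) (6 * e)"
  proof -
    have "xi M mu p * (6 * e) \<le> 6 * e" using xi_bounds e by simp
    moreover have "l = xi M mu p ^ k \<or> l = 6 * e" unfolding l_def by linarith
    ultimately show ?thesis unfolding l'_def by auto
  qed
  then have "\<forall>s\<in>{s \<in> E2. lam * w 1 - l' \<le> S 1 s}. lam * w 1 - max (xi M mu p ^ Suc k) (6 * e) \<le> S 1 s"
    by auto
  ultimately show ?case by blast
qed

lemma lower_bounds:
  assumes "xi M mu p ^ k \<le> 6 * e"
  shows "bad {s. \<forall>r\<in>{1..M}. lower (6 * e) r \<le> S r s}
    \<le> (1 + 1 / e) ^ (k * (2 * M - 1) + (M - 1)) / (1 + e) ^ J"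
proof -
  obtain E where E: "good (k * (2 * M - 1)) E" "\<And>s. s \<in> E \<Longrightarrow> lam * w 1 - 6 * e \<le> S 1 s"
    using peeling_iteration[of k] assms by (auto simp: max_def)
  obtain E' where E': "good (k * (2 * M - 1) + (M - 1)) E'"
    "\<forall>s\<in>E'. \<forall>r\<in>{1..M}. lower (6 * e) r \<le> S r s"
    using lower_all[OF _ E] e by auto
  have "bad {s. \<forall>r\<in>{1..M}. lower (6 * e) r \<le> S r s} \<le> bad E'"
    unfolding bad_def using E'(2) finite_SS pi_nonneg by (intro sum_mono2) auto
  moreover have "0 \<le> 1 / (1 + e) ^ J" using e by simp
  ultimately show ?thesis using E'(1) unfolding good_def \<kappa>_def times_divide_eq_right mult_1_right
    by linarith
qed

end

section \<open>Choice of the parameters\<close>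

context coxian_phases
begin

lemma vbar_le: "m \<in> {1..M} \<Longrightarrow> vbar M mu p \<le> w m"
  unfolding vbar_def by simp

lemma vbar_nonneg: "0 \<le> vbar M mu p"
  unfolding vbar_def using w_nonneg M by (subst Min_ge_iff) auto

lemma M_vbar_le_1: "real M * vbar M mu p \<le> 1"
proof -
  have "of_nat (card {1..M}) * vbar M mu p \<le> (\<Sum>m\<in>{1..M}. w m)"
    by (rule sum_bounded_below) (rule vbar_le)
  then show ?thesis using norm by simp
qed

text \<open>For \<open>M \<le> 2\<close> we have \<open>xi = 0\<close>, hence \<open>ln (1 / xi) = ln 0 = 0\<close> and \<open>Cconst = 0\<close>.\<close>

lemma Cconst_pos_imp:
  fixes L :: real
  assumes C: "0 < Cconst M mu p"
  defines "L \<equiv> ln (1 / xi M mu p)"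
  shows "0 < xi M mu p" "2 \<le> M" "0 < L" "0 < vbar M mu p"
    "(vbar M mu p)\<^sup>2 = (Cconst M mu p)\<^sup>2 * (3 * real M / L + 3 * real M + 4) / 2"
    "Cconst M mu p \<le> vbar M mu p"
proof -
  have pos: "0 < 2 * (vbar M mu p)\<^sup>2 * L / (3 * real M + (3 * real M + 4) * L)"
    using C unfolding Cconst_def L_def real_sqrt_gt_0_iff .
  show xi: "0 < xi M mu p"
  proof (rule ccontr)
    assume "\<not> 0 < xi M mu p"
    then have "xi M mu p = 0" using xi_bounds by simp
    then show False using pos unfolding L_def by simp
  qed
  show "2 \<le> M"
  proof (rule ccontr)
    assume "\<not> 2 \<le> M"
    then show False using xi unfolding xi_def by simp
  qed
  show L: "0 < L" using xi xi_bounds unfolding L_def by simp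
  have "vbar M mu p \<noteq> 0" using pos by (intro notI) simp
  then show v: "0 < vbar M mu p" using vbar_nonneg by simp
  have "(Cconst M mu p)\<^sup>2 = 2 * (vbar M mu p)\<^sup>2 * L / (3 * real M + (3 * real M + 4) * L)"
    unfolding Cconst_def L_def[symmetric] using pos by (intro real_sqrt_pow2 less_imp_le)
  moreover define K where "K = 3 * real M / L + 3 * real M + 4"
  have KL: "3 * real M + (3 * real M + 4) * L = K * L"
    unfolding K_def using L by (simp add: field_simps)
  have K: "2 \<le> K" unfolding K_def using L by (simp add: add_increasing)
  ultimately have C2: "(Cconst M mu p)\<^sup>2 = 2 * (vbar M mu p)\<^sup>2 / K" using L unfolding KL by simp
  have eq: "(vbar M mu p)\<^sup>2 = (Cconst M mu p)\<^sup>2 * K / 2" unfolding C2 using K by simp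
  then show "(vbar M mu p)\<^sup>2 = (Cconst M mu p)\<^sup>2 * (3 * real M / L + 3 * real M + 4) / 2"
    unfolding K_def .
  have "(Cconst M mu p)\<^sup>2 * 2 \<le> (Cconst M mu p)\<^sup>2 * K" using K by (intro mult_left_mono) auto
  then have "(Cconst M mu p)\<^sup>2 \<le> (vbar M mu p)\<^sup>2" unfolding eq by linarith
  then show "Cconst M mu p \<le> vbar M mu p" by (rule power2_le_imp_le) (rule vbar_nonneg)
qed

end

text \<open>The origin of \<open>C\<close>. About \<open>x / (2 * L)\<close> rounds contribute
  factors of at most \<open>R = exp (x / 2)\<close>, so the accumulated exponent is quadratic in
  \<open>x\<close> with coefficient \<open>M / (2 * L)\<close>, plus linear terms. The decay
  exponent is about \<open>J * e / 2\<close>, where \<open>J * e\<close> is nearly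
  \<open>vb * x\<^sup>2 / C\<^sup>2\<close>, and \<open>C\<close> makes this at least
  \<open>K * x\<^sup>2\<close>.\<close>

lemma error_estimate:
  fixes x L C vb e R :: real and M k J :: nat
  assumes x: "2 \<le> x" and L: "0 < L" and C: "0 < C" "C \<le> vb" and M: "2 \<le> M" "real M * vb \<le> 1"
    and vb: "vb\<^sup>2 = C\<^sup>2 * (3 * real M / L + 3 * real M + 4) / 2"
    and R: "R = exp (x / 2)" and e: "e = x / (C * R)" "e \<le> 1 / 8"
    and J: "R\<^sup>2 * vb * e - 2 \<le> real J" and k: "real k \<le> x / (2 * L) + 1"
  shows "(1 + 1 / e) ^ (k * (2 * M - 1) + (M - 1)) / (1 + e) ^ J \<le> exp (- (3 * x))"
proof -
  define n where "n = k * (2 * M - 1) + (M - 1)"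
  define K where "K = 3 * real M / L + 3 * real M + 4"
  have Rpos: "0 < R" unfolding R by simp
  have e0: "0 < e" unfolding e using x C Rpos by simp
  have R2: "2 \<le> R" unfolding R using exp_ge_add_one_self[of "x / 2"] x by linarith
  have vb0: "0 < vb" using C by simp
  have "2 * vb \<le> real M * vb" using M vb0 by (intro mult_right_mono) auto
  then have C2: "C \<le> 1 / 2" using M C by linarith
  have "1 / e = C * R / x" unfolding e by simp
  also have "\<dots> \<le> (1 / 2 * R) / 2" using C2 Rpos x C by (intro frac_le mult_right_mono) auto
  finally have base: "1 + 1 / e \<le> R" using R2 by simp
  have "(1 + 1 / e) ^ n \<le> R ^ n" using base e0 by (intro power_mono) auto
  also have "R ^ n = exp (real n * (x / 2))" unfolding R by (rule exp_of_nat_mult[symmetric])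
  finally have 1: "(1 + 1 / e) ^ n \<le> exp (real n * (x / 2))" .
  \<comment> \<open>Turns the power into an exponential at the cost of a factor 2 in the exponent;
    here \<open>e\<close> must be small.\<close>
  have "exp (e / 2) \<le> 1 + e"
    using exp_bound_lemma[of "e / 2"] e(2) e0 by simp
  then have "exp (e / 2) ^ J \<le> (1 + e) ^ J" by (intro power_mono) auto
  then have 2: "exp (real J * (e / 2)) \<le> (1 + e) ^ J" by (simp only: exp_of_nat_mult)
  have "(1 + 1 / e) ^ n / (1 + e) ^ J \<le> exp (real n * (x / 2)) / exp (real J * (e / 2))"
    using 1 2 e0 by (intro frac_le) auto
  also have "\<dots> = exp (real n * (x / 2) - real J * (e / 2))" by (simp add: exp_diff)
  also have "\<dots> \<le> exp (- (3 * x))"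
  proof -
    have "real n \<le> 2 * real M * real k + real M"
    proof -
      have "k * (2 * M - 1) \<le> k * (2 * M)" by (intro mult_left_mono) auto
      then have "n \<le> k * (2 * M) + M" unfolding n_def by linarith
      then have "real n \<le> real (k * (2 * M) + M)" by (simp only: of_nat_le_iff)
      then show ?thesis by (simp add: mult_ac)
    qed
    also have "\<dots> \<le> 2 * real M * (x / (2 * L) + 1) + real M" using k by (intro add_mono mult_left_mono) auto
    also have "\<dots> = real M * x / L + 3 * real M" by (simp add: field_simps)
    finally have "real n * (x / 2) \<le> (real M * x / L + 3 * real M) * (x / 2)"
      using x by (intro mult_right_mono) auto
    then have n: "real n * (x / 2) \<le> real M / L * x\<^sup>2 / 2 + 3 * (real M * x) / 2"
      by (simp add: power2_eq_square field_simps)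
    have "(R\<^sup>2 * vb * e - 2) * e \<le> real J * e" using J e0 by (intro mult_right_mono) auto
    moreover have "(R\<^sup>2 * vb * e) * e = vb * x\<^sup>2 / C\<^sup>2"
      unfolding e using Rpos C by (simp add: power2_eq_square)
    moreover have "vb * x\<^sup>2 / C\<^sup>2 \<ge> K * x\<^sup>2"
    proof -
      have "C\<^sup>2 * K = 2 * (vb * vb)" using vb unfolding K_def by (simp add: power2_eq_square)
      also have "\<dots> \<le> vb"
      proof -
        have "2 * vb \<le> 1" using \<open>2 * vb \<le> real M * vb\<close> M by linarith
        then show ?thesis using mult_left_le_one_le[of vb "2 * vb"] vb0 by simp
      qed
      finally have "C\<^sup>2 * K * x\<^sup>2 \<le> vb * x\<^sup>2" by (intro mult_right_mono) auto
      then show ?thesis using C by (simp add: field_simps)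
    qed
    ultimately have J: "K * x\<^sup>2 - 2 * e \<le> real J * e" by (simp add: left_diff_distrib)
    have K: "K * x\<^sup>2 = 3 * (real M / L * x\<^sup>2) + 3 * (real M * x\<^sup>2) + 4 * x\<^sup>2"
      unfolding K_def by (simp add: field_simps)
    have "2 * x \<le> x\<^sup>2" using x by (simp add: power2_eq_square)
    moreover from this have "real M * x \<le> real M * x\<^sup>2" using x by (intro mult_left_mono) auto
    moreover have "0 \<le> real M / L * x\<^sup>2" using L by simp
    moreover have "real J * (e / 2) = real J * e / 2" by simp
    \<comment> \<open>The nonlinear terms are abstracted: \<open>P\<close>, \<open>Q\<close>,
      \<open>Q'\<close>, \<open>X\<close> stand for \<open>M / L * x\<^sup>2\<close>,
      \<open>M * x\<close>, \<open>M * x\<^sup>2\<close>, \<open>x\<^sup>2\<close>, and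
      \<open>j\<close> for \<open>J * e\<close>. What remains is linear.\<close>
    moreover have "a - c \<le> - (3 * x)"
      if "a \<le> P / 2 + 3 * Q / 2" "c = j / 2" "z - 2 * e \<le> j" "z = 3 * P + 3 * Q' + 4 * X"
        "0 \<le> P" "Q \<le> Q'" "2 * x \<le> X" for a c P Q Q' X z j :: real
      using that e(2) x by linarith
    ultimately show ?thesis unfolding exp_le_cancel_iff using n J K by blast
  qed
  finally show ?thesis unfolding n_def .
qed

theorem theorem1:
  fixes N b M :: nat and \<alpha> :: real
    and mu p :: "nat \<Rightarrow> real"
    and pol :: "state \<Rightarrow> target \<Rightarrow> real"
    and \<pi> :: "state \<Rightarrow> real"
  defines "lam \<equiv> 1 - real N powr (- \<alpha>)"
  assumes hb: "b \<ge> 1" and hM: "M \<ge> 1" and hN: "N \<ge> 1"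
    and h\<alpha>: "0 < \<alpha>" "\<alpha> < 1/2"
    and hmu: "\<forall>m\<in>{1..M}. mu m > 0"
    and hp: "\<forall>m\<in>{1..<M}. 0 \<le> p m \<and> p m < 1"
    and hnorm: "(\<Sum>m=1..M. v mu p m) = 1"
    and hpol: "\<forall>s\<in>state_space N b M lam mu p pol. policy_ok N b M pol s"
    and hLB0: "\<forall>s\<in>state_space N b M lam mu p pol.
                 (\<Sum>m=1..M. real (s 1 m) / real N) \<le> 1 - 1 / (real N powr \<alpha> * ln (real N))
                 \<longrightarrow> A1 b M pol s \<le> 1 / sqrt (real N)"
    and hirr: "irreducible N b M lam mu p pol"
    and hstat: "stationary N b M lam mu p pol \<pi>"
    and hN1: "min (\<Sum>m=1..M. theta M mu p m)
                  (Cconst M mu p * (1 - xi M mu p) / (2 * mu 1 * CM M mu p))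
                * real N powr (0.5 - \<alpha>) \<ge> ln (real N)"
    and hN2: "ln (real N) \<ge> max (2 * mu 1 / (1 - xi M mu p)) (Cconst M mu p / mu 1)"
  shows "\<forall>m\<in>{1..M}.
    (\<Sum>s\<in>{s\<in>state_space N b M lam mu p pol.
          lam * v mu p m - theta M mu p m * ln (real N) / sqrt (real N) \<le> real (s 1 m) / real N
        \<and> real (s 1 m) / real N \<le> lam * v mu p m + 1 / real N powr \<alpha>
            + (\<Sum>r\<in>{1..M}-{m}. theta M mu p r) * ln (real N) / sqrt (real N)}. \<pi> s)
    \<ge> 1 - real M / real N ^ 3"
proof -
  interpret P: coxian_phases M mu p
    using hM hmu hp hnorm by unfold_locales auto
  define x C A L vb where "x = ln (real N)" and "C = Cconst M mu p" and "A = P.aprod M"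
    and "L = ln (1 / xi M mu p)" and "vb = vbar M mu p"
  define R where "R = sqrt (real N)"
  define e where "e = x / (C * R)"
  define \<tau> where "\<tau> = 1 / (real N powr \<alpha> * x)"
  define \<sigma> where "\<sigma> = 1 / R"
  have A: "0 < A" "A \<le> 1" using P.aprod_bounds[of M] unfolding A_def by auto
  have m1: "1 \<le> mu 1" by (rule P.mu_1_ge)
  have xi: "1 - xi M mu p = mu 1 * A" using P.xi_eq unfolding A_def by simp
  have xA: "2 / A \<le> x" using hN2 m1 unfolding xi x_def by simp
  have "2 \<le> 2 / A" using A by (simp add: field_simps)
  then have x: "2 \<le> x" using xA by linarith
  have N: "0 < real N" using hN by simp
  have RN: "R\<^sup>2 = real N" "0 < R" unfolding R_def using N by auto
  have Rx: "R = exp (x / 2)"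
    unfolding R_def x_def using N by (simp add: ln_sqrt[symmetric])
  have pw: "0 < real N powr (0.5 - \<alpha>)" using N by simp
  have mins: "0 < min (\<Sum>m=1..M. theta M mu p m) (C * (1 - xi M mu p) / (2 * mu 1 * CM M mu p))"
    using hN1 x pw unfolding x_def[symmetric] C_def[symmetric]
    by (smt (verit) mult_nonpos_nonneg)
  \<comment> \<open>If \<open>C = 0\<close>, every \<open>theta\<close> is 0 because division by
    zero yields 0, and the left inequality would give \<open>log N \<le> 0\<close>, contradicting
    \<open>x \<ge> 2\<close>.\<close>
  have C: "0 < C"
  proof (rule ccontr)
    assume "\<not> 0 < C"
    moreover have "0 \<le> 6 * mu 1 * v mu p m + 5 * (real m - 1) * v mu p m" if "m \<in> {1..M}" for m
      using P.w_nonneg[OF that] m1 that by auto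
    ultimately have "(\<Sum>m=1..M. theta M mu p m) \<le> 0"
      unfolding theta_def C_def[symmetric] by (intro sum_nonpos divide_nonneg_nonpos) auto
    then show False using mins by simp
  qed
  note CC = P.Cconst_pos_imp[OF C[unfolded C_def], folded C_def L_def vb_def]
  have CM: "4 \<le> CM M mu p" by (rule P.CM_ge_4[OF CC(2)])
  have e0: "0 < e" unfolding e_def using x C RN by simp
  \<comment> \<open>The second entry of the minimum reserves half of the spare capacity
    \<open>N powr (- \<alpha>) * A\<close> for the accumulated errors.\<close>
  have CMe: "CM M mu p * e \<le> real N powr (- \<alpha>) * A / 2"
  proof -
    have "x \<le> C * (1 - xi M mu p) / (2 * mu 1 * CM M mu p) * real N powr (0.5 - \<alpha>)"
      using hN1 mult_right_mono[OF min.cobounded2[of "\<Sum>m=1..M. theta M mu p m"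
          "C * (1 - xi M mu p) / (2 * mu 1 * CM M mu p)"], of "real N powr (0.5 - \<alpha>)"] pw
      unfolding x_def C_def by linarith
    also have "real N powr (0.5 - \<alpha>) = R * real N powr (- \<alpha>)"
      unfolding R_def using powr_add[of "real N" "1 / 2" "- \<alpha>"] N by (simp add: powr_half_sqrt)
    also have "C * (1 - xi M mu p) / (2 * mu 1 * CM M mu p) = C * A / (2 * CM M mu p)"
      unfolding xi using m1 by simp
    finally have "x * (2 * CM M mu p) \<le> C * A * (R * real N powr (- \<alpha>))"
      using CM by (simp add: field_simps)
    then show ?thesis unfolding e_def using C RN by (simp add: field_simps)
  qed
  have Npw: "real N powr (- \<alpha>) \<le> 1" "0 < real N powr (- \<alpha>)"
    using hN h\<alpha> by (auto simp: powr_mono[of "-\<alpha>" 0 "real N", simplified])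
  have "4 * e \<le> CM M mu p * e" using CM e0 by (intro mult_right_mono) auto
  moreover have "real N powr (- \<alpha>) * A \<le> 1 * 1" using Npw A by (intro mult_mono) auto
  ultimately have e8: "e \<le> 1 / 8" using CMe by linarith
  \<comment> \<open>The other half pays for \<open>\<tau>\<close>, as
    \<open>log N \<ge> 2 * mu 1 / (1 - xi)\<close> means \<open>1 / x \<le> A / 2\<close>.\<close>
  have budget: "\<tau> + CM M mu p * e \<le> (1 - lam) * P.aprod M"
  proof -
    have "1 / x \<le> A / 2" using xA A x by (simp add: field_simps)
    then have "real N powr (- \<alpha>) * (1 / x) \<le> real N powr (- \<alpha>) * (A / 2)"
      using Npw by (intro mult_left_mono) auto
    moreover have "\<tau> = real N powr (- \<alpha>) * (1 / x)" unfolding \<tau>_def by (simp add: powr_minus field_simps)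
    moreover have "real N powr (- \<alpha>) * (A / 2) = real N powr (- \<alpha>) * A / 2" by simp
    ultimately have "\<tau> + CM M mu p * e \<le> real N powr (- \<alpha>) * A" using CMe by linarith
    then show ?thesis unfolding lam_def A_def by simp
  qed
  \<comment> \<open>The condition \<open>log N \<ge> C / mu 1\<close> is exactly
    \<open>1 / sqrt N \<le> mu 1 * e\<close>.\<close>
  have xC: "C \<le> mu 1 * x" using hN2 m1 unfolding x_def C_def by (simp add: field_simps)
  have \<sigma>: "0 \<le> \<sigma>" "\<sigma> \<le> mu 1 * e"
    unfolding \<sigma>_def e_def using xC C RN by (simp_all add: field_simps)
  have "1 * 1 \<le> R * (x * (vb / C))"
    using CC(6) C x exp_ge_add_one_self[of "x / 2"] unfolding Rx
    by (intro mult_mono mult_ge1_I[of x]) (auto simp: mult_ge1_I)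
  also have "\<dots> = real N * vb * e"
    unfolding RN(1)[symmetric] e_def using RN C by (simp add: power2_eq_square field_simps)
  finally have NJ: "1 \<le> real N * vb * e" by simp
  define J where "J = nat \<lfloor>real N * vb * e - 1\<rfloor>"
  have J: "real J + 1 \<le> real N * vb * e" "real N * vb * e - 2 \<le> real J"
    unfolding J_def using NJ by linarith+
  interpret Q: coxian_system M mu p N b lam pol \<pi>
    using hb hN Npw hpol hstat by unfold_locales (auto simp: lam_def)
  interpret Z: lb_zero_system M mu p N b lam pol \<pi> e \<tau> \<sigma> vb J
  proof unfold_locales
    show "1 - \<sigma> \<le> pol s None"
      if s: "s \<in> Q.SS" and le: "(\<Sum>m\<in>{1..M}. real (s 1 m) / real N) \<le> 1 - \<tau>" for s
    proof -
      have "A1 b M pol s \<le> \<sigma>"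
        using hLB0 s le unfolding Q.SS_def \<tau>_def \<sigma>_def R_def x_def by blast
      moreover have "pol s None + A1 b M pol s = 1"
        using Q.pol_SS[OF s] unfolding policy_ok_def A1_def by blast
      ultimately show ?thesis by simp
    qed
  qed (use CC P.vbar_le e0 J budget \<sigma> in \<open>auto simp: vb_def\<close>)
  \<comment> \<open>Enough rounds for \<open>xi ^ k \<le> exp (- x / 2) = 1 / sqrt N\<close>, which
    is below \<open>6 * e\<close> because \<open>C \<le> x\<close>.\<close>
  define k where "k = nat \<lceil>x / (2 * L)\<rceil>"
  have k: "x / (2 * L) \<le> real k" "real k \<le> x / (2 * L) + 1"
    unfolding k_def using x CC(3) by (auto intro: real_nat_ceiling_ge)
  have "xi M mu p = exp (- L)" unfolding L_def using CC(1) by (simp add: ln_div)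
  then have "xi M mu p ^ k = exp (- (real k * L))" by (simp add: exp_of_nat_mult[symmetric])
  also have "\<dots> \<le> exp (- (x / 2))" using k(1) CC(3) by (simp add: field_simps)
  also have "\<dots> = 1 / R" unfolding Rx by (simp add: exp_minus field_simps)
  also have "\<dots> \<le> 6 * e"
  proof -
    have "2 * vb \<le> real M * vb" using CC(2,4) by (intro mult_right_mono) auto
    then have "C \<le> x" using CC(6) P.M_vbar_le_1 x CC(4) unfolding vb_def by linarith
    then show ?thesis unfolding e_def using C RN by (simp add: field_simps)
  qed
  finally have xik: "xi M mu p ^ k \<le> 6 * e" .
  define G where "G = {s. \<forall>r\<in>{1..M}. Z.lower (6 * e) r \<le> Q.S r s}"
  have "Q.bad G \<le> (1 + 1 / e) ^ (k * (2 * M - 1) + (M - 1)) / (1 + e) ^ J"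
    unfolding G_def by (rule Z.lower_bounds[OF xik])
  also have "\<dots> \<le> exp (- (3 * x))"
    using x CC C P.M_vbar_le_1 Rx e8 J k RN
    by (intro error_estimate[where C = C and L = L and vb = vb and R = R]) (auto simp: e_def vb_def)
  also have "\<dots> = 1 / real N ^ 3"
  proof -
    have "exp (3 * x) = real N ^ 3"
      using exp_of_nat_mult[of 3 x] N unfolding x_def by simp
    then show ?thesis by (simp add: exp_minus field_simps)
  qed
  also have "\<dots> \<le> real M / real N ^ 3" using hM N by (intro divide_right_mono) auto
  finally have badG: "Q.bad G \<le> real M / real N ^ 3" .
  have theta: "theta M mu p r * x / R = 6 * mu 1 * v mu p r * e + 5 * (real r - 1) * v mu p r * e" for r
    unfolding theta_def e_def C_def[symmetric] using C RN by (simp add: field_simps)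
  have low: "Z.lower (6 * e) r = lam * v mu p r - theta M mu p r * x / R" for r
    unfolding Z.lower_def theta by (simp add: algebra_simps)
  show ?thesis
  proof
    fix m assume m: "m \<in> {1..M}"
    let ?X = "{s\<in>state_space N b M lam mu p pol.
          lam * v mu p m - theta M mu p m * ln (real N) / sqrt (real N) \<le> real (s 1 m) / real N
        \<and> real (s 1 m) / real N \<le> lam * v mu p m + 1 / real N powr \<alpha>
            + (\<Sum>r\<in>{1..M}-{m}. theta M mu p r) * ln (real N) / sqrt (real N)}"
    have sub: "Q.SS \<inter> G \<subseteq> ?X"
    proof
      fix s assume s: "s \<in> Q.SS \<inter> G"
      have lo: "Z.lower (6 * e) r \<le> Q.S r s" if "r \<in> {1..M}" for r
        using s that unfolding G_def by auto
      \<comment> \<open>The upper bound for phase \<open>m\<close> needs no further tail estimate: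
        total mass at most 1, the lower bounds of the other phases and \<open>\<Sum> v = 1\<close>
        leave \<open>lam * v m\<close>, the spare capacity
        \<open>1 - lam = N powr (- \<alpha>)\<close> and the other \<open>theta\<close> terms. Hence
        one event \<open>G\<close> serves all \<open>m\<close>.\<close>
      have "(\<Sum>r\<in>{1..M}-{m}. lam * v mu p r - theta M mu p r * x / R) \<le> (\<Sum>r\<in>{1..M}-{m}. Q.S r s)"
        using lo low by (intro sum_mono) auto
      moreover have "(\<Sum>r\<in>{1..M}-{m}. lam * v mu p r - theta M mu p r * x / R)
          = lam * (1 - v mu p m) - (\<Sum>r\<in>{1..M}-{m}. theta M mu p r) * x / R"
        using hnorm m unfolding sum_subtractf sum_distrib_left[symmetric] sum_divide_distrib[symmetric]
          sum_distrib_right[symmetric] by (simp add: sum_diff1)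
      moreover have "Q.S m s + (\<Sum>r\<in>{1..M}-{m}. Q.S r s) \<le> 1"
        using Q.sum_S_le_1[of s] s sum.remove[of "{1..M}" m "\<lambda>r. Q.S r s"] m by simp
      ultimately have "Q.S m s \<le> lam * v mu p m + (1 - lam) + (\<Sum>r\<in>{1..M}-{m}. theta M mu p r) * x / R"
        by (simp add: algebra_simps)
      moreover have "1 - lam = 1 / real N powr \<alpha>" unfolding lam_def by (simp add: powr_minus_divide)
      ultimately show "s \<in> ?X"
        using lo[OF m] s unfolding low Q.S_def Q.SS_def x_def R_def by simp
    qed
    have "1 = Q.bad G + sum \<pi> (Q.SS \<inter> G)"
      using Q.pi_sum sum.Int_Diff[OF Q.finite_SS, of \<pi> G] unfolding Q.bad_def by simp
    moreover have "sum \<pi> (Q.SS \<inter> G) \<le> sum \<pi> ?X"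
      using Q.finite_SS Q.pi_nonneg sub unfolding Q.SS_def[symmetric]
      by (intro sum_mono2) auto
    ultimately show "1 - real M / real N ^ 3 \<le> sum \<pi> ?X" using badG by linarith
  qed
qed

end
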